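(* The gap emptiness problem is decidable for the class of polynomially ambiguous probabilistic automata. That is, there is an algorithm which, given a rational $\epsilon \in \mathbb{Q}\cap(0,1)$ and a polynomially ambiguous probabilistic automaton $\mathcal{A}$ over an alphabet $\Sigma$ such that either there is a word $w\in\Sigma^*$ with $[\![\mathcal{A}]\!](w) > \frac12+\epsilon$, or $[\![\mathcal{A}]\!](w)\le \frac12$ for all words $w\in\Sigma^*$, always terminates and correctly determines whether $[\![\mathcal{A}]\!](w)\le\frac12$ holds for all $w \in \Sigma^*$.
   Context: A distribution over a finite set $S$ is a function $f:S\to\mathbb{Q}_{\ge 0}$ with $\sum_{s\in S} f(s)\le 1$; $\mathcal{D}(S)$ is the set of distributions over $S$. A probabilistic automaton (PA) is a tuple $\mathcal{A}=(\Sigma,Q,\delta,\iota,F)$ with finite alphabet $\Sigma$, finite state set $Q$, transition function $\delta:Q\times\Sigma\to\mathcal{D}(Q)$ (write $\delta(q,a,p)=\delta(q,a)(p)$), initial distribution $\iota\in\mathcal{D}(Q)$ and final states $F\subseteq Q$. A run over $w=a_1\dots a_n$ is a sequence of transitions $(q_0,a_1,q_1),\dots,(q_{n-1},a_n,q_n)$ with $\delta(q_{i-1},a_i,q_i)>0$ for all $1\le i\le n$; it is accepting if $\iota(q_0)>0$ and $q_n\in F$. Its probability is $\iota(q_0)\prod_{i=1}^n\delta(q_{i-1},a_i,q_i)$. $[\![\mathcal{A}]\!](w)$ is the sum of the probabilities of all accepting runs over $w$. $\mathcal{A}$ is polynomially ambiguous if there is a polynomial $P$ such that for every word $w$ the number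 of accepting runs of $\mathcal{A}$ over $w$ is at most $P(|w|)$. The problem is a promise problem: nothing is required on inputs violating the stated alternative. *)

theory Defs
  imports Complex_Main "HOL-Library.Nat_Bijection" "HOL-Computational_Algebra.Polynomial"
begin

section \<open>Partial recursive functions\<close>

text \<open>
  Algorithms are programs for Kleene's partial recursive functions on tuples of natural numbers;
  \<open>None\<close> means that the computation does not terminate (or that the arity is wrong).
\<close>

datatype recf = Zero | Succ | Proj nat | Comp recf "recf list" | Prec recf recf | Mu recf

fun eval_recf :: "recf \<Rightarrow> nat list \<Rightarrow> nat option" where
  "eval_recf Zero xs = Some 0"
| "eval_recf Succ xs = (case xs of [x] \<Rightarrow> Some (Suc x) | _ \<Rightarrow> None)"
| "eval_recf (Proj i) xs = (if i < length xs then Some (xs ! i) else None)"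
| "eval_recf (Comp f gs) xs =
     (let rs = map (\<lambda>g. eval_recf g xs) gs
      in if None \<in> set rs then None else eval_recf f (map the rs))"
| "eval_recf (Prec f g) xs =
     (case xs of
        [] \<Rightarrow> None
      | n # ys \<Rightarrow>
          rec_nat (eval_recf f ys) (\<lambda>k r. Option.bind r (\<lambda>y. eval_recf g (k # y # ys))) n)"
| "eval_recf (Mu f) xs =
     (if \<exists>n. eval_recf f (n # xs) = Some 0 \<and> (\<forall>m<n. eval_recf f (m # xs) \<noteq> None)
      then Some (LEAST n. eval_recf f (n # xs) = Some 0)
      else None)"


section \<open>Probabilistic automata\<close>

definition distribution :: "'s set \<Rightarrow> ('s \<Rightarrow> rat) \<Rightarrow> bool" where
  "distribution S f \<longleftrightarrow> (\<forall>s\<in>S. 0 \<le> f s) \<and> (\<Sum>s\<in>S. f s) \<le> 1"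

record ('a, 'q) pa =
  alphabet :: "'a set"
  states :: "'q set"
  trans_prob :: "'q \<Rightarrow> 'a \<Rightarrow> 'q \<Rightarrow> rat"
  init_prob :: "'q \<Rightarrow> rat"
  final :: "'q set"

definition prob_automaton :: "('a, 'q) pa \<Rightarrow> bool" where
  "prob_automaton A \<longleftrightarrow>
     finite (alphabet A) \<and> finite (states A) \<and>
     (\<forall>q\<in>states A. \<forall>a\<in>alphabet A. distribution (states A) (trans_prob A q a)) \<and>
     distribution (states A) (init_prob A) \<and>
     final A \<subseteq> states A"

text \<open>
  A run over \<open>w\<close> is given by the sequence of states \<open>q\<^sub>0, \<dots>, q\<^sub>n\<close> that it visits; together with
  \<open>w\<close> this determines its transitions.  The runs over the empty word are the single states.
\<close>

definition is_run :: "('a, 'q) pa \<Rightarrow> 'a list \<Rightarrow> 'q list \<Rightarrow> bool" where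
  "is_run A w qs \<longleftrightarrow>
     length qs = Suc (length w) \<and> set qs \<subseteq> states A \<and>
     (\<forall>i<length w. trans_prob A (qs ! i) (w ! i) (qs ! Suc i) > 0)"

definition accepting_runs :: "('a, 'q) pa \<Rightarrow> 'a list \<Rightarrow> 'q list set" where
  "accepting_runs A w =
     {qs. is_run A w qs \<and> init_prob A (qs ! 0) > 0 \<and> qs ! length w \<in> final A}"

definition run_prob :: "('a, 'q) pa \<Rightarrow> 'a list \<Rightarrow> 'q list \<Rightarrow> rat" where
  "run_prob A w qs =
     init_prob A (qs ! 0) * (\<Prod>i<length w. trans_prob A (qs ! i) (w ! i) (qs ! Suc i))"

definition word_prob :: "('a, 'q) pa \<Rightarrow> 'a list \<Rightarrow> rat" where
  "word_prob A w = (\<Sum>qs\<in>accepting_runs A w. run_prob A w qs)"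

definition polynomially_ambiguous :: "('a, 'q) pa \<Rightarrow> bool" where
  "polynomially_ambiguous A \<longleftrightarrow>
     (\<exists>P :: real poly. \<forall>w\<in>lists (alphabet A).
        real (card (accepting_runs A w)) \<le> poly P (real (length w)))"


section \<open>Encoding of the inputs\<close>

text \<open>
  Letters and states are named by natural numbers, so that the alphabet and the state set are
  arbitrary finite subsets of \<open>\<nat>\<close>; the transition and initial probabilities are tabulated in
  increasing order of these names.
\<close>

definition rat_code :: "rat \<Rightarrow> nat" where
  "rat_code r = (case quotient_of r of (n, d) \<Rightarrow> prod_encode (int_encode n, nat d))"

definition input_code :: "rat \<Rightarrow> (nat, nat) pa \<Rightarrow> nat" where
  "input_code \<epsilon> A =
     (let as = sorted_list_of_set (alphabet A); qs = sorted_list_of_set (states A)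
      in list_encode
           [rat_code \<epsilon>,
            list_encode as,
            list_encode qs,
            list_encode [rat_code (trans_prob A q a p). q \<leftarrow> qs, a \<leftarrow> as, p \<leftarrow> qs],
            list_encode [rat_code (init_prob A q). q \<leftarrow> qs],
            list_encode (sorted_list_of_set (final A))])"

end

theory Submission
  imports Defs "HOL-Library.FuncSet"
begin

text \<open>
  Call a transition of probability less than 1 random.  A transition of probability 1 has no
  alternative, so runs branch only at random transitions.  In a polynomially ambiguous automaton no
  useful state has two distinct cycles over the same word; hence, with every suffix of a run ranked
  by its position in the order of strongly connected components and by its width inside the
  component, at most one successor of a random transition keeps the rank.  It follows that the
  number of accepting runs with \<open>k\<close> random transitions is bounded polynomially in \<open>k\<close>, uniformly in
  the word, whereas the probability of such a run decays exponentially in \<open>k\<close>.  So up to \<open>\<epsilon>\<close> only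
  the runs with at most \<open>K\<close> random transitions matter, for a computable \<open>K\<close>.  With a common
  denominator \<open>D\<close>, the vector of their accepting probabilities (indexed by state and number of random
  transitions) consists of multiples of \<open>1 / D ^ K\<close> in \<open>[0, 1]\<close>; by the pigeonhole principle
  every such vector is attained by a word of computably bounded length.  If some word
  has probability above \<open>1/2 + \<epsilon>\<close>, then some word within this bound has probability above \<open>1/2\<close>, and
  checking all words up to the bound decides the problem.
\<close>

section \<open>Computable functions\<close>

text \<open>Computability concerns functions of the whole tuple, so a compound expression is handled
  by closure rules applied under a single lambda.\<close>

definition computable :: "nat \<Rightarrow> (nat list \<Rightarrow> nat) \<Rightarrow> bool" where
  "computable k f \<longleftrightarrow> (\<exists>r. \<forall>xs. length xs = k \<longrightarrow> eval_recf r xs = Some (f xs))"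

lemma computable_Comp:
  assumes "computable (length gs) f" and "\<And>g. g \<in> set gs \<Longrightarrow> computable k g"
  shows "computable k (\<lambda>xs. f (map (\<lambda>g. g xs) gs))"
proof -
  obtain r where r: "\<And>xs. length xs = length gs \<Longrightarrow> eval_recf r xs = Some (f xs)"
    using assms(1) unfolding computable_def by blast
  obtain G where G: "\<And>g xs. g \<in> set gs \<Longrightarrow> length xs = k \<Longrightarrow> eval_recf (G g) xs = Some (g xs)"
    using assms(2) unfolding computable_def by metis
  have "eval_recf (Comp r (map G gs)) xs = Some (f (map (\<lambda>g. g xs) gs))" if "length xs = k" for xs
  proof -
    have *: "map (\<lambda>g. eval_recf g xs) (map G gs) = map Some (map (\<lambda>g. g xs) gs)"
      using G that by auto
    show ?thesis by (simp only: eval_recf.simps * Let_def) (auto simp: r comp_def)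
  qed
  then show ?thesis unfolding computable_def by blast
qed

lemma computable_app1:
  assumes "computable (Suc 0) (\<lambda>xs. f (hd xs))" "computable k a"
  shows "computable k (\<lambda>xs. f (a xs))"
  using computable_Comp[of "[a]" "\<lambda>xs. f (hd xs)" k] assms by simp

lemma computable_app2:
  assumes "computable (Suc (Suc 0)) (\<lambda>xs. f (hd xs) (hd (tl xs)))" "computable k a" "computable k b"
  shows "computable k (\<lambda>xs. f (a xs) (b xs))"
  using computable_Comp[of "[a, b]" "\<lambda>xs. f (hd xs) (hd (tl xs))" k] assms by auto

lemma computable_app3:
  assumes "computable (Suc (Suc (Suc 0))) (\<lambda>xs. f (hd xs) (hd (tl xs)) (hd (tl (tl xs))))"
    "computable k a" "computable k b" "computable k c"
  shows "computable k (\<lambda>xs. f (a xs) (b xs) (c xs))"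
  using computable_Comp[of "[a, b, c]" "\<lambda>xs. f (hd xs) (hd (tl xs)) (hd (tl (tl xs)))" k] assms by auto

lemma computable_Suc: "computable k a \<Longrightarrow> computable k (\<lambda>xs. Suc (a xs))"
proof (rule computable_app1[of Suc])
  have "eval_recf Succ xs = Some (Suc (hd xs))" if "length xs = Suc 0" for xs
    using that by (cases xs) auto
  then show "computable (Suc 0) (\<lambda>xs. Suc (hd xs))" unfolding computable_def by blast
qed

lemma computable_const: "computable k (\<lambda>xs. c)"
proof (induction c)
  case 0
  have "eval_recf Zero xs = Some 0" for xs by simp
  then show ?case unfolding computable_def by blast
next
  case (Suc c)
  then show ?case by (rule computable_Suc)
qed

lemma computable_nth: "i < k \<Longrightarrow> computable k (\<lambda>xs. xs ! i)"
  unfolding computable_def by (rule exI[of _ "Proj i"]) auto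

lemma computable_cong: "computable k f \<Longrightarrow> (\<And>xs. length xs = k \<Longrightarrow> f xs = g xs) \<Longrightarrow> computable k g"
  unfolding computable_def by (erule ex_forward) simp

text \<open>Recursion, sum and product push their bound variables onto the front of the tuple, so
  variables are addressed by nested \<open>hd\<close> and \<open>tl\<close>. Five levels suffice:
  input, word length, word, state sequence, position.\<close>

lemma computable_var0: "computable (Suc k) hd"
  by (rule computable_cong[OF computable_nth[of "0"]]) (auto simp: length_Suc_conv)

lemma computable_var1: "computable (Suc (Suc k)) (\<lambda>xs. hd (tl xs))"
  by (rule computable_cong[OF computable_nth[of "Suc 0"]]) (auto simp: length_Suc_conv)

lemma computable_var2: "computable (Suc (Suc (Suc k))) (\<lambda>xs. hd (tl (tl xs)))"
  using computable_nth[of "Suc (Suc 0)"]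
  by (rule computable_cong) (simp_all add: hd_conv_nth nth_tl flip: length_0_conv)

lemma computable_var3: "computable (Suc (Suc (Suc (Suc k)))) (\<lambda>xs. hd (tl (tl (tl xs))))"
  using computable_nth[of "Suc (Suc (Suc 0))"]
  by (rule computable_cong) (simp_all add: hd_conv_nth nth_tl flip: length_0_conv)

lemma computable_var4: "computable (Suc (Suc (Suc (Suc (Suc k))))) (\<lambda>xs. hd (tl (tl (tl (tl xs)))))"
  using computable_nth[of "Suc (Suc (Suc (Suc 0)))"]
  by (rule computable_cong) (simp_all add: hd_conv_nth nth_tl flip: length_0_conv)

lemmas computable_vars =
  computable_var0 computable_var1 computable_var2 computable_var3 computable_var4

lemma computable_rec:
  assumes "computable k a" "computable k n"
    and "computable (Suc (Suc k)) (\<lambda>ys. s (hd ys) (hd (tl ys)) (tl (tl ys)))"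
  shows "computable k (\<lambda>xs. rec_nat (a xs) (\<lambda>i y. s i y xs) (n xs))"
proof -
  obtain ra rn rs
    where ra: "\<And>xs. length xs = k \<Longrightarrow> eval_recf ra xs = Some (a xs)"
      and rn: "\<And>xs. length xs = k \<Longrightarrow> eval_recf rn xs = Some (n xs)"
      and rs: "\<And>ys. length ys = Suc (Suc k) \<Longrightarrow>
        eval_recf rs ys = Some (s (hd ys) (hd (tl ys)) (tl (tl ys)))"
    using assms unfolding computable_def by metis
  \<comment> \<open>\<open>Prec\<close> expects the counter in front of the parameters, so the
    projections rebuild the tuple behind the computed counter.\<close>
  have "eval_recf (Comp (Prec ra rs) (rn # map Proj [0..<k])) xs =
      Some (rec_nat (a xs) (\<lambda>i y. s i y xs) (n xs))" if len: "length xs = k" for xs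
  proof -
    have "map (\<lambda>g. eval_recf g xs) (rn # map Proj [0..<k]) = map Some (n xs # map ((!) xs) [0..<k])"
      using rn len by auto
    moreover have "map ((!) xs) [0..<k] = xs" using len map_nth by blast
    ultimately have *: "map (\<lambda>g. eval_recf g xs) (rn # map Proj [0..<k]) = map Some (n xs # xs)"
      by simp
    have **: "rec_nat (eval_recf ra xs) (\<lambda>k r. Option.bind r (\<lambda>y. eval_recf rs (k # y # xs))) j =
        Some (rec_nat (a xs) (\<lambda>i y. s i y xs) j)" for j
      by (induction j) (auto simp: ra rs len)
    show ?thesis by (simp only: eval_recf.simps(4) * Let_def) (auto simp: ** comp_def)
  qed
  then show ?thesis unfolding computable_def by blast
qed

section \<open>Arithmetic by primitive recursion\<close>

lemma computable_add:
  assumes "computable k a" "computable k b" shows "computable k (\<lambda>xs. a xs + b xs)"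
proof -
  have "rec_nat x (\<lambda>_ y. Suc y) n = x + n" for x n :: nat by (induction n) auto
  then show ?thesis
    using computable_rec[OF assms, of "\<lambda>i y xs. Suc y"] computable_Suc[OF computable_var1] by auto
qed

lemma computable_mult:
  assumes "computable k a" "computable k b" shows "computable k (\<lambda>xs. a xs * b xs)"
proof -
  have "rec_nat 0 (\<lambda>_ y. y + x) n = x * n" for x n :: nat by (induction n) auto
  moreover have "computable 2 (\<lambda>xs. rec_nat 0 (\<lambda>_ y. y + hd xs) (hd (tl xs)))"
    by (simp only: numeral_2_eq_2) (intro computable_rec computable_const computable_add computable_vars)
  ultimately show ?thesis
    using computable_app2[of "(*)", OF _ assms] by (simp add: numeral_2_eq_2)
qed

lemma computable_pow:
  assumes "computable k a" "computable k b" shows "computable k (\<lambda>xs. a xs ^ b xs)"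
proof -
  have "rec_nat (Suc 0) (\<lambda>_ y. y * x) n = x ^ n" for x n :: nat by (induction n) auto
  moreover have "computable 2 (\<lambda>xs. rec_nat (Suc 0) (\<lambda>_ y. y * hd xs) (hd (tl xs)))"
    by (simp only: numeral_2_eq_2) (intro computable_rec computable_const computable_mult computable_vars)
  ultimately show ?thesis
    using computable_app2[of "(^)", OF _ assms] by (simp add: numeral_2_eq_2)
qed

lemma computable_fact:
  assumes "computable k a" shows "computable k (\<lambda>xs. fact (a xs))"
proof -
  have "rec_nat (Suc 0) (\<lambda>i y. Suc i * y) n = fact n" for n :: nat by (induction n) auto
  moreover have "computable (Suc 0) (\<lambda>xs. rec_nat (Suc 0) (\<lambda>i y. Suc i * y) (hd xs))"
    by (intro computable_rec computable_const computable_Suc computable_mult computable_vars)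
  ultimately show ?thesis
    using computable_app1[of fact, OF _ assms] by simp
qed

lemma computable_pred:
  assumes "computable k a" shows "computable k (\<lambda>xs. a xs - Suc 0)"
proof -
  have "rec_nat 0 (\<lambda>i y. i) n = n - Suc 0" for n :: nat by (cases n) auto
  moreover have "computable (Suc 0) (\<lambda>xs. rec_nat 0 (\<lambda>i y. i) (hd xs))"
    by (intro computable_rec computable_const computable_vars)
  ultimately show ?thesis
    using computable_app1[of "\<lambda>x. x - Suc 0", OF _ assms] by simp
qed

lemma computable_diff:
  assumes "computable k a" "computable k b" shows "computable k (\<lambda>xs. a xs - b xs)"
proof -
  have "rec_nat x (\<lambda>_ y. y - Suc 0) n = x - n" for x n :: nat by (induction n) auto
  moreover have "computable 2 (\<lambda>xs. rec_nat (hd xs) (\<lambda>_ y. y - Suc 0) (hd (tl xs)))"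
    by (simp only: numeral_2_eq_2) (intro computable_rec computable_pred computable_vars)
  ultimately show ?thesis
    using computable_app2[of "(-)", OF _ assms] by (simp add: numeral_2_eq_2)
qed

lemma computable_if0:
  assumes "computable k a" "computable k b" "computable k c"
  shows "computable k (\<lambda>xs. if a xs = 0 then b xs else c xs)"
proof -
  have "rec_nat x (\<lambda>_ _. y) n = (if n = 0 then x else y)" for x y n :: nat by (cases n) auto
  moreover have "computable 3 (\<lambda>xs. rec_nat (hd (tl xs)) (\<lambda>_ _. hd (tl (tl xs))) (hd xs))"
    by (simp only: numeral_3_eq_3) (intro computable_rec computable_vars)
  ultimately show ?thesis
    using computable_app3[of "\<lambda>n x y. if n = 0 then x else y", OF _ assms] by (simp add: numeral_3_eq_3)
qed

lemma computable_if_le: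
  assumes "computable k a" "computable k b" "computable k c" "computable k d"
  shows "computable k (\<lambda>xs. if a xs \<le> b xs then c xs else d xs)"
  using computable_if0[OF computable_diff[OF assms(1,2)] assms(3,4)] by simp

lemma computable_if_eq:
  assumes "computable k a" "computable k b" "computable k c" "computable k d"
  shows "computable k (\<lambda>xs. if a xs = b xs then c xs else d xs)"
proof -
  have "(a - b) + (b - a) = 0 \<longleftrightarrow> a = b" for a b :: nat by auto
  then show ?thesis
    using computable_if0[OF computable_add[OF computable_diff[OF assms(1,2)] computable_diff[OF assms(2,1)]]
      assms(3,4)] by simp
qed

text \<open>A recursion step also receives the accumulated value, which a summand or factor ignores;
  this inserts the dummy second argument.\<close>

lemma computable_weaken1:
  assumes "computable (Suc k) (\<lambda>ys. f (hd ys) (tl ys))"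
  shows "computable (Suc (Suc k)) (\<lambda>xs. f (hd xs) (tl (tl xs)))"
proof -
  let ?gs = "map (\<lambda>i. \<lambda>xs :: nat list. xs ! i) (0 # [2..<Suc (Suc k)])"
  have "computable (length ?gs) (\<lambda>ys. f (hd ys) (tl ys))" using assms by (simp del: upt_Suc)
  then have "computable (Suc (Suc k)) (\<lambda>xs. (\<lambda>ys. f (hd ys) (tl ys)) (map (\<lambda>g. g xs) ?gs))"
    by (rule computable_Comp) (auto intro!: computable_nth simp del: upt_Suc)
  then show ?thesis
  proof (rule computable_cong)
    fix xs :: "nat list" assume l: "length xs = Suc (Suc k)"
    then obtain x y zs where xs: "xs = x # y # zs" "length zs = k"
      by (auto simp: length_Suc_conv)
    have "map ((!) xs) [2..<Suc (Suc k)] = zs"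
      using xs by (intro nth_equalityI) (auto simp: nth_append simp del: upt_Suc)
    then show "(\<lambda>ys. f (hd ys) (tl ys)) (map (\<lambda>g. g xs) ?gs) = f (hd xs) (tl (tl xs))"
      using xs by (simp add: comp_def del: upt_Suc)
  qed
qed

lemma computable_sum:
  assumes "computable k n" "computable (Suc k) (\<lambda>ys. f (hd ys) (tl ys))"
  shows "computable k (\<lambda>xs. \<Sum>i<n xs. f i xs)"
proof -
  have "rec_nat 0 (\<lambda>i y. y + f i xs) n = (\<Sum>i<n. f i xs)" for n xs by (induction n) auto
  then show ?thesis
    using computable_rec[OF computable_const[of k 0] assms(1), of "\<lambda>i y xs. y + f i xs"]
      computable_add[OF computable_var1 computable_weaken1[OF assms(2)]] by auto
qed

lemma computable_prod:
  assumes "computable k n" "computable (Suc k) (\<lambda>ys. f (hd ys) (tl ys))"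
  shows "computable k (\<lambda>xs. \<Prod>i<n xs. f i xs)"
proof -
  have "rec_nat 1 (\<lambda>i y. y * f i xs) n = (\<Prod>i<n. f i xs)" for n xs by (induction n) auto
  then show ?thesis
    using computable_rec[OF computable_const[of k 1] assms(1), of "\<lambda>i y xs. y * f i xs"]
      computable_mult[OF computable_var1 computable_weaken1[OF assms(2)]] by auto
qed

text \<open>The quotient is the number of positive multiples of the divisor not exceeding the
  dividend; a bounded sum counts them.\<close>

lemma computable_div:
  assumes "computable k a" "computable k b" shows "computable k (\<lambda>xs. a xs div b xs)"
proof -
  have "(\<Sum>i<x. if Suc i * y \<le> x then 1 else 0) = x div y" if "y > 0" for x y :: nat
  proof -
    have "(\<Sum>i<x. if Suc i * y \<le> x then 1 else 0) = card ({..<x} \<inter> {i. Suc i * y \<le> x})"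
      by (simp add: sum.If_cases del: mult_Suc)
    also have "{..<x} \<inter> {i. Suc i * y \<le> x} = {..<x div y}"
    proof -
      have "Suc i * y \<le> x \<longleftrightarrow> i < x div y" for i
        by (simp only: less_eq_div_iff_mult_less_eq[OF that, symmetric] Suc_le_eq)
      moreover have "i < x" if "i < x div y" for i
        using that div_le_dividend less_le_trans by blast
      ultimately show ?thesis by blast
    qed
    finally show ?thesis by simp
  qed
  \<comment> \<open>For \<open>y = 0\<close> the count would be \<open>x\<close>, whereas
    \<open>x div 0 = 0\<close>.\<close>
  then have *: "(if y = 0 then 0 else \<Sum>i<x. if Suc i * y \<le> x then 1 else 0) = x div y" for x y :: nat
    by (cases "y = 0") simp_all
  have "computable (Suc (Suc 0)) (\<lambda>xs. if hd (tl xs) = 0 then 0 else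
      \<Sum>i<hd xs. if Suc i * hd (tl xs) \<le> hd xs then 1 else 0)"
    by (intro computable_if0 computable_sum computable_if_le computable_const computable_mult
        computable_Suc computable_vars)
  then show ?thesis
    unfolding * by (rule computable_app2[of "(div)", OF _ assms])
qed

lemma computable_mod:
  assumes "computable k a" "computable k b" shows "computable k (\<lambda>xs. a xs mod b xs)"
  using computable_diff[OF assms(1) computable_mult[OF computable_div[OF assms] assms(2)]]
  by (simp add: minus_div_mult_eq_mod)

lemmas computable_intros = computable_vars computable_const computable_Suc computable_add
  computable_mult computable_pow computable_fact computable_pred computable_diff
  computable_if0 computable_if_le computable_if_eq computable_rec computable_sum computable_prod
  computable_div computable_mod

section \<open>Pairing and list codes\<close>

lemma computable_prod_encode:
  assumes "computable k a" "computable k b" shows "computable k (\<lambda>xs. prod_encode (a xs, b xs))"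
proof -
  have "(\<Sum>i<Suc n. i) = triangle n" for n by (induction n) auto
  then have *: "(\<Sum>i<Suc (m + n). i) + m = prod_encode (m, n)" for m n
    by (simp add: prod_encode_def)
  show ?thesis
    unfolding *[symmetric] by (intro computable_intros assms)
qed

definition pfst :: "nat \<Rightarrow> nat" where "pfst z = fst (prod_decode z)"
definition psnd :: "nat \<Rightarrow> nat" where "psnd z = snd (prod_decode z)"

lemma pfst_encode [simp]: "pfst (prod_encode (a, b)) = a"
  and psnd_encode [simp]: "psnd (prod_encode (a, b)) = b"
  by (simp_all add: pfst_def psnd_def)

text \<open>Unpairing by exhaustive search: both components are at most \<open>z\<close> and pairing
  is injective, so exactly one pair in the square passes the test.\<close>

lemma sum_prod_encode_eq:
  fixes h :: "nat \<Rightarrow> nat \<Rightarrow> nat"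
  shows "(\<Sum>a<Suc z. \<Sum>b<Suc z. if prod_encode (a, b) = z then h a b else 0) = h (pfst z) (psnd z)"
proof -
  obtain a0 b0 where z: "z = prod_encode (a0, b0)"
    by (metis prod_decode_inverse surj_pair)
  have *: "prod_encode (a, b) = z \<longleftrightarrow> b = b0 \<and> a = a0" for a b by (auto simp: z)
  have le: "a0 < Suc z" "b0 < Suc z"
    unfolding z by (auto simp: less_Suc_eq_le le_prod_encode_1 le_prod_encode_2)
  have "(\<Sum>b<Suc z. if prod_encode (a, b) = z then h a b else 0) = (if a = a0 then h a0 b0 else 0)" for a
    using le unfolding * by (cases "a = a0") (auto simp del: sum.lessThan_Suc)
  then show ?thesis using le by (simp add: z del: sum.lessThan_Suc)
qed

lemma computable_pfst:
  assumes "computable k a" shows "computable k (\<lambda>xs. pfst (a xs))"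
proof (rule computable_app1[of pfst, OF _ assms])
  have "computable (Suc 0) (\<lambda>xs. \<Sum>a<Suc (hd xs). \<Sum>b<Suc (hd xs).
      if prod_encode (a, b) = hd xs then a else 0)"
    by (intro computable_intros computable_prod_encode)
  then show "computable (Suc 0) (\<lambda>xs. pfst (hd xs))"
    by (simp only: sum_prod_encode_eq)
qed

lemma computable_psnd:
  assumes "computable k a" shows "computable k (\<lambda>xs. psnd (a xs))"
proof (rule computable_app1[of psnd, OF _ assms])
  have "computable (Suc 0) (\<lambda>xs. \<Sum>a<Suc (hd xs). \<Sum>b<Suc (hd xs).
      if prod_encode (a, b) = hd xs then b else 0)"
    by (intro computable_intros computable_prod_encode)
  then show "computable (Suc 0) (\<lambda>xs. psnd (hd xs))"
    by (simp only: sum_prod_encode_eq)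
qed

text \<open>\<open>list_encode\<close> puts \<open>Suc\<close> around the pair of head and tail, so
  one is subtracted before unpairing.\<close>

definition code_tl :: "nat \<Rightarrow> nat" where "code_tl l = psnd (l - Suc 0)"
definition code_drop :: "nat \<Rightarrow> nat \<Rightarrow> nat" where "code_drop l i = rec_nat l (\<lambda>_ y. code_tl y) i"
definition code_nth :: "nat \<Rightarrow> nat \<Rightarrow> nat" where "code_nth l i = pfst (code_drop l i - Suc 0)"
text \<open>A list is never longer than its code, so \<open>l\<close> itself bounds the positions to
  be inspected; the code 0 means the empty suffix.\<close>

definition code_length :: "nat \<Rightarrow> nat" where
  "code_length l = (\<Sum>i<l. if code_drop l i = 0 then 0 else 1)"

lemma computable_code_drop:
  assumes "computable k a" "computable k b" shows "computable k (\<lambda>xs. code_drop (a xs) (b xs))"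
  unfolding code_drop_def code_tl_def by (intro assms computable_intros computable_psnd)

lemma computable_code_nth:
  assumes "computable k a" "computable k b" shows "computable k (\<lambda>xs. code_nth (a xs) (b xs))"
  unfolding code_nth_def by (intro assms computable_intros computable_code_drop computable_pfst)

lemma computable_code_length:
  assumes "computable k a" shows "computable k (\<lambda>xs. code_length (a xs))"
proof (rule computable_app1[of code_length, OF _ assms])
  show "computable (Suc 0) (\<lambda>xs. code_length (hd xs))"
    unfolding code_length_def by (intro computable_intros computable_code_drop)
qed

lemma code_drop_encode: "code_drop (list_encode xs) i = list_encode (drop i xs)"
proof (induction i)
  case (Suc i)
  have "code_drop (list_encode xs) (Suc i) = code_tl (list_encode (drop i xs))"
    using Suc by (simp add: code_drop_def)
  also have "\<dots> = list_encode (drop (Suc i) xs)"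
  proof (cases "drop i xs")
    case Nil
    \<comment> \<open>Dropping past the end is harmless: the code 0 of the empty list has tail 0,
      since \<open>prod_decode 0\<close> is \<open>(0, 0)\<close>.\<close>
    moreover have "prod_decode 0 = (0, 0)"
      using prod_encode_inverse[of "(0, 0)"] by (simp add: prod_encode_def)
    ultimately show ?thesis by (simp add: code_tl_def psnd_def)
  next
    case (Cons y ys)
    then have "drop (Suc i) xs = ys" by (simp add: drop_Suc flip: tl_drop)
    with Cons show ?thesis by (simp add: code_tl_def)
  qed
  finally show ?case .
qed (simp add: code_drop_def)

lemma code_nth_encode:
  assumes "i < length xs" shows "code_nth (list_encode xs) i = xs ! i"
proof -
  have "list_encode (drop i xs) = list_encode (xs ! i # drop (Suc i) xs)"
    using assms by (simp only: Cons_nth_drop_Suc)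
  then show ?thesis by (simp add: code_nth_def code_drop_encode)
qed

lemma length_le_list_encode: "length xs \<le> list_encode xs"
proof (induction xs)
  case (Cons x xs)
  then show ?case using le_prod_encode_2[of "list_encode xs" x] by simp
qed simp

lemma mem_le_list_encode: "x \<in> set xs \<Longrightarrow> x \<le> list_encode xs"
proof (induction xs)
  case (Cons y xs)
  then show ?case using le_prod_encode_2[of "list_encode xs" y] le_prod_encode_1[of y "list_encode xs"]
    by (auto simp: le_Suc_eq)
qed simp

lemma code_length_encode: "code_length (list_encode xs) = length xs"
proof -
  have "list_encode ys = 0 \<longleftrightarrow> ys = []" for ys by (cases ys) simp_all
  then have "code_drop (list_encode xs) i = 0 \<longleftrightarrow> \<not> i < length xs" for i
    by (simp add: code_drop_encode not_less)
  then have "code_length (list_encode xs) = (\<Sum>i<list_encode xs. if i < length xs then 1 else 0)"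
    unfolding code_length_def by (intro sum.cong) simp_all
  also have "\<dots> = card ({..<list_encode xs} \<inter> {i. i < length xs})"
    by (simp add: sum.If_cases)
  also have "{..<list_encode xs} \<inter> {i. i < length xs} = {..<length xs}"
    using length_le_list_encode[of xs] by auto
  finally show ?thesis by simp
qed

lemmas computable_code_intros = computable_intros computable_pfst computable_psnd computable_code_nth
  computable_code_length

section \<open>Runs and ambiguity\<close>

text \<open>The semiring is left open so that one recursion yields acceptance probabilities, numbers
  of runs and discounted numbers of runs, according to the transition weights.\<close>

fun path_sum :: "'q set \<Rightarrow> ('q \<Rightarrow> 'a \<Rightarrow> 'q \<Rightarrow> 'r) \<Rightarrow> ('q \<Rightarrow> 'r) \<Rightarrow> 'q \<Rightarrow> 'a list \<Rightarrow> 'r :: comm_semiring_1"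
  where
    "path_sum S W f q [] = f q"
  | "path_sum S W f q (a # w) = (\<Sum>p\<in>S. W q a p * path_sum S W f p w)"

lemma sum_lists_Suc:
  "(\<Sum>qs | length qs = Suc n \<and> set qs \<subseteq> S. g qs) =
    (\<Sum>q\<in>S. \<Sum>qs | length qs = n \<and> set qs \<subseteq> S. g (q # qs))" if "finite S"
proof -
  have "(\<Sum>q\<in>S. \<Sum>qs | length qs = n \<and> set qs \<subseteq> S. g (q # qs)) =
      (\<Sum>(q, qs)\<in>S \<times> {qs. length qs = n \<and> set qs \<subseteq> S}. g (q # qs))"
    by (simp add: sum.cartesian_product)
  also have "\<dots> = (\<Sum>qs | length qs = Suc n \<and> set qs \<subseteq> S. g qs)"
    by (rule sum.reindex_bij_witness[of _ "\<lambda>qs. (hd qs, tl qs)" "\<lambda>(q, qs). q # qs"])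
      (auto simp: length_Suc_conv)
  finally show ?thesis ..
qed

text \<open>Distributivity lets the first state be summed out. The induction varies
  \<open>i\<close>, because the weight of the first transition becomes the initial weight of the
  remaining sequence.\<close>

lemma sum_lists_path_sum:
  assumes "finite S"
  shows "(\<Sum>qs | length qs = Suc (length w) \<and> set qs \<subseteq> S.
      i (qs ! 0) * (\<Prod>j<length w. W (qs ! j) (w ! j) (qs ! Suc j)) * f (qs ! length w)) =
    (\<Sum>q\<in>S. i q * path_sum S W f q w)"
proof (induction w arbitrary: i)
  case Nil
  have [simp]: "{qs. qs = [] \<and> set qs \<subseteq> S} = {[]}" by auto
  show ?case using assms by (simp add: sum_lists_Suc)
next
  case (Cons a w)
  have "(\<Sum>qs | length qs = Suc (length (a # w)) \<and> set qs \<subseteq> S.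
      i (qs ! 0) * (\<Prod>j<length (a # w). W (qs ! j) ((a # w) ! j) (qs ! Suc j)) * f (qs ! length (a # w)))
    = (\<Sum>q\<in>S. i q * (\<Sum>qs | length qs = Suc (length w) \<and> set qs \<subseteq> S.
      W q a (qs ! 0) * (\<Prod>j<length w. W (qs ! j) (w ! j) (qs ! Suc j)) * f (qs ! length w)))"
    unfolding sum_lists_Suc[OF assms, where n = "length (a # w)"]
    by (simp add: prod.lessThan_Suc_shift sum_distrib_left mult.assoc del: prod.lessThan_Suc)
  then show ?case by (simp only: Cons.IH path_sum.simps)
qed

lemma path_sum_nonneg:
  fixes W :: "'q \<Rightarrow> 'a \<Rightarrow> 'q \<Rightarrow> 'r :: linordered_semidom"
  assumes "\<And>q a p. q \<in> S \<Longrightarrow> a \<in> \<Sigma> \<Longrightarrow> p \<in> S \<Longrightarrow> 0 \<le> W q a p" "\<And>q. q \<in> S \<Longrightarrow> 0 \<le> f q"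
    and "q \<in> S" "w \<in> lists \<Sigma>"
  shows "0 \<le> path_sum S W f q w"
  using assms(4,3) by (induction arbitrary: q) (auto intro!: sum_nonneg mult_nonneg_nonneg assms)

locale prob_aut =
  fixes A :: "('a, 'q) pa"
  assumes prob_automaton: "prob_automaton A"
begin

abbreviation "Q \<equiv> states A"
abbreviation "\<Sigma> \<equiv> alphabet A"
abbreviation "\<delta> \<equiv> trans_prob A"
abbreviation "\<iota> \<equiv> init_prob A"

lemma finite_states: "finite Q"
  and finite_alphabet: "finite \<Sigma>"
  and init_nonneg: "q \<in> Q \<Longrightarrow> 0 \<le> \<iota> q"
  and init_sum: "(\<Sum>q\<in>Q. \<iota> q) \<le> 1"
  and trans_nonneg: "q \<in> Q \<Longrightarrow> a \<in> \<Sigma> \<Longrightarrow> p \<in> Q \<Longrightarrow> 0 \<le> \<delta> q a p"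
  and trans_sum: "q \<in> Q \<Longrightarrow> a \<in> \<Sigma> \<Longrightarrow> (\<Sum>p\<in>Q. \<delta> q a p) \<le> 1"
  and final_subset: "final A \<subseteq> Q"
  using prob_automaton unfolding prob_automaton_def distribution_def by auto

lemma trans_one_unique:
  assumes "q \<in> Q" "a \<in> \<Sigma>" "p \<in> Q" "p' \<in> Q" "\<delta> q a p = 1" "p' \<noteq> p"
  shows "\<delta> q a p' = 0"
proof -
  have "\<delta> q a p + \<delta> q a p' = (\<Sum>r\<in>{p, p'}. \<delta> q a r)" using assms by simp
  also have "\<dots> \<le> (\<Sum>r\<in>Q. \<delta> q a r)"
    using assms by (intro sum_mono2) (auto simp: finite_states trans_nonneg)
  finally show ?thesis using trans_sum[of q a] trans_nonneg[of q a p'] assms by simp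
qed

definition accept_prob :: "'q \<Rightarrow> 'a list \<Rightarrow> rat" where
  "accept_prob = path_sum Q \<delta> (\<lambda>q. of_bool (q \<in> final A))"

definition run_count :: "'q \<Rightarrow> 'a list \<Rightarrow> nat" where
  "run_count = path_sum Q (\<lambda>q a p. of_bool (\<delta> q a p > 0)) (\<lambda>q. of_bool (q \<in> final A))"

lemma accepting_runs_subset:
  "accepting_runs A w \<subseteq> {qs. length qs = Suc (length w) \<and> set qs \<subseteq> Q}"
  by (auto simp: accepting_runs_def is_run_def)

lemma finite_lists: "finite {qs. length qs = n \<and> set qs \<subseteq> Q}"
  using finite_lists_length_eq[OF finite_states, of n] by (simp add: conj_commute)

text \<open>Sequences that are not accepting runs may be added to the sum: weights are nonnegative,
  so a weight that fails to be positive is a zero factor, and so is the indicator of a non-final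
  last state.\<close>

lemma word_prob_sum:
  assumes "w \<in> lists \<Sigma>"
  shows "word_prob A w = (\<Sum>qs | length qs = Suc (length w) \<and> set qs \<subseteq> Q.
      \<iota> (qs ! 0) * (\<Prod>j<length w. \<delta> (qs ! j) (w ! j) (qs ! Suc j)) * of_bool (qs ! length w \<in> final A))"
  unfolding word_prob_def
proof (rule sum.mono_neutral_cong_left[OF finite_lists accepting_runs_subset])
  show "\<forall>qs\<in>{qs. length qs = Suc (length w) \<and> set qs \<subseteq> Q} - accepting_runs A w.
      \<iota> (qs ! 0) * (\<Prod>j<length w. \<delta> (qs ! j) (w ! j) (qs ! Suc j)) * of_bool (qs ! length w \<in> final A) = 0"
  proof
    fix qs assume qs: "qs \<in> {qs. length qs = Suc (length w) \<and> set qs \<subseteq> Q} - accepting_runs A w"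
    then have mem: "qs ! j \<in> Q" if "j \<le> length w" for j
      using that by (auto simp: less_Suc_eq_le subset_iff)
    have letter: "w ! j \<in> \<Sigma>" if "j < length w" for j using assms that by auto
    from qs consider j where "j < length w" "\<not> \<delta> (qs ! j) (w ! j) (qs ! Suc j) > 0"
      | "\<not> \<iota> (qs ! 0) > 0" | "qs ! length w \<notin> final A"
      by (auto simp: accepting_runs_def is_run_def)
    then show "\<iota> (qs ! 0) * (\<Prod>j<length w. \<delta> (qs ! j) (w ! j) (qs ! Suc j)) *
        of_bool (qs ! length w \<in> final A) = 0"
    proof cases
      case 1
      then have "\<delta> (qs ! j) (w ! j) (qs ! Suc j) = 0"
        using trans_nonneg[OF mem[of j] letter[of j] mem[of "Suc j"]] by simp
      with 1(1) have "(\<Prod>j<length w. \<delta> (qs ! j) (w ! j) (qs ! Suc j)) = 0"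
        by (intro prod_zero) auto
      then show ?thesis by simp
    next
      case 2
      then have "\<iota> (qs ! 0) = 0" using init_nonneg[OF mem[of 0]] by simp
      then show ?thesis by simp
    qed simp
  qed
qed (simp add: run_prob_def accepting_runs_def)

lemma word_prob_eq:
  assumes "w \<in> lists \<Sigma>"
  shows "word_prob A w = (\<Sum>q\<in>Q. \<iota> q * accept_prob q w)"
  unfolding word_prob_sum[OF assms] accept_prob_def by (rule sum_lists_path_sum[OF finite_states])

lemma card_accepting_runs_eq:
  "card (accepting_runs A w) = (\<Sum>q\<in>Q. of_bool (\<iota> q > 0) * run_count q w)"
proof -
  have "card (accepting_runs A w) = (\<Sum>qs\<in>accepting_runs A w. 1)" by simp
  also have "\<dots> = (\<Sum>qs | length qs = Suc (length w) \<and> set qs \<subseteq> Q. of_bool (\<iota> (qs ! 0) > 0) *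
      (\<Prod>j<length w. of_bool (\<delta> (qs ! j) (w ! j) (qs ! Suc j) > 0)) * of_bool (qs ! length w \<in> final A))"
  proof (rule sum.mono_neutral_cong_left[OF finite_lists accepting_runs_subset], rule ballI)
    fix qs assume qs: "qs \<in> {qs. length qs = Suc (length w) \<and> set qs \<subseteq> Q} - accepting_runs A w"
    then consider j where "j < length w" "\<not> \<delta> (qs ! j) (w ! j) (qs ! Suc j) > 0"
      | "\<not> \<iota> (qs ! 0) > 0" | "qs ! length w \<notin> final A"
      by (auto simp: accepting_runs_def is_run_def)
    then show "of_bool (\<iota> (qs ! 0) > 0) *
      (\<Prod>j<length w. of_bool (\<delta> (qs ! j) (w ! j) (qs ! Suc j) > 0)) * of_bool (qs ! length w \<in> final A)
        = (0 :: nat)"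
      by cases auto
  qed (simp add: accepting_runs_def is_run_def)
  also have "\<dots> = (\<Sum>q\<in>Q. of_bool (\<iota> q > 0) * run_count q w)"
    unfolding run_count_def by (rule sum_lists_path_sum[OF finite_states])
  finally show ?thesis .
qed

section \<open>Reachability and pumping of cycles\<close>

fun reach :: "'q \<Rightarrow> 'a list \<Rightarrow> 'q \<Rightarrow> bool" where
  "reach q [] p \<longleftrightarrow> q = p"
| "reach q (a # w) p \<longleftrightarrow> (\<exists>r\<in>Q. \<delta> q a r > 0 \<and> reach r w p)"

lemma reach_append: "reach q (u @ v) p \<longleftrightarrow> (\<exists>r. reach q u r \<and> reach r v p)"
  by (induction u arbitrary: q) auto

lemma reach_state: "reach q w p \<Longrightarrow> q \<in> Q \<Longrightarrow> p \<in> Q"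
  by (induction w arbitrary: q) auto

lemma run_count_reach: "reach q u p \<Longrightarrow> run_count p z \<le> run_count q (u @ z)"
proof (induction u arbitrary: q)
  case (Cons a u)
  then obtain r where r: "r \<in> Q" "\<delta> q a r > 0" "reach r u p" by auto
  have "run_count p z \<le> run_count r (u @ z)" using r Cons.IH by blast
  also have "\<dots> = of_bool (\<delta> q a r > 0) * run_count r (u @ z)" using r by simp
  also have "\<dots> \<le> (\<Sum>r\<in>Q. of_bool (\<delta> q a r > 0) * run_count r (u @ z))"
    using r finite_states by (intro member_le_sum) auto
  finally show ?case by (simp add: run_count_def)
qed simp

text \<open>Runs through \<open>q1\<close> and runs through \<open>q2\<close> differ after one step,
  so their numbers add up.\<close>

lemma run_count_double:
  assumes "q1 \<in> Q" "q2 \<in> Q" "q1 \<noteq> q2" "\<delta> q a q1 > 0" "\<delta> q a q2 > 0" "reach q1 u q" "reach q2 u q"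
  shows "2 * run_count q z \<le> run_count q ((a # u) @ z)"
proof -
  have "2 * run_count q z \<le> run_count q1 (u @ z) + run_count q2 (u @ z)"
    using run_count_reach[of q1 u q z] run_count_reach[of q2 u q z] assms by simp
  also have "\<dots> = (\<Sum>r\<in>{q1, q2}. of_bool (\<delta> q a r > 0) * run_count r (u @ z))"
    using assms by simp
  also have "\<dots> \<le> (\<Sum>r\<in>Q. of_bool (\<delta> q a r > 0) * run_count r (u @ z))"
    using assms finite_states by (intro sum_mono2) auto
  finally show ?thesis by (simp add: run_count_def)
qed

lemma run_count_pow:
  assumes "\<And>z. 2 * run_count q z \<le> run_count q (v @ z)"
  shows "2 ^ n * run_count q z \<le> run_count q (concat (replicate n v) @ z)"
proof (induction n)
  case (Suc n)
  have "2 ^ Suc n * run_count q z = 2 * (2 ^ n * run_count q z)" by simp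
  also have "\<dots> \<le> 2 * run_count q (concat (replicate n v) @ z)" using Suc by simp
  also have "\<dots> \<le> run_count q (v @ concat (replicate n v) @ z)" by (rule assms)
  finally show ?case by simp
qed simp

end

lemma power_times_half_power_tendsto_0: "(\<lambda>n. real n ^ i * (1 / 2) ^ n) \<longlonglongrightarrow> 0"
proof (cases "i = 0")
  case True
  then show ?thesis using LIMSEQ_power_zero[of "1 / 2 :: real"] by simp
next
  case False
  \<comment> \<open>Taking an \<open>i\<close>-th root reduces the claim to \<open>n * y ^ n\<close>
    tending to 0 for a single \<open>y\<close> below 1, raised to the power
    \<open>i\<close>.\<close>
  define y where "y = root i (1 / 2)"
  have y: "y ^ i = 1 / 2" "norm y < 1"
    using False by (simp_all add: y_def)
  have "(\<lambda>n. (real n * y ^ n) ^ i) \<longlonglongrightarrow> 0 ^ i"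
    by (intro tendsto_power powser_times_n_limit_0 y)
  moreover have "(real n * y ^ n) ^ i = real n ^ i * (1 / 2) ^ n" for n
    by (simp only: power_mult_distrib power_commutes y(1)[symmetric] flip: power_mult) (simp add: mult.commute)
  ultimately show ?thesis using False by (simp add: power_0_left)
qed

lemma poly_linear_less_pow2:
  fixes P :: "real poly"
  shows "\<exists>n. poly P (real (a + b * n)) < 2 ^ n"
proof -
  \<comment> \<open>Substituting the linear length leaves one polynomial in \<open>n\<close>, whose
    monomials are each beaten by \<open>2 ^ n\<close>.\<close>
  define R where "R = pcompose P [:real a, real b:]"
  have R: "poly P (real (a + b * n)) = poly R (real n)" for n
    by (simp add: R_def poly_pcompose algebra_simps)
  have "(\<lambda>n. \<Sum>i\<le>degree R. coeff R i * (real n ^ i * (1 / 2) ^ n)) \<longlonglongrightarrow> (\<Sum>i\<le>degree R. coeff R i * 0)"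
    by (intro tendsto_intros power_times_half_power_tendsto_0)
  then have "(\<lambda>n. poly R (real n) / 2 ^ n) \<longlonglongrightarrow> 0"
    by (simp add: poly_altdef sum_divide_distrib power_divide field_simps)
  then have "eventually (\<lambda>n. poly R (real n) / 2 ^ n < 1) sequentially"
    by (rule order_tendstoD) simp
  then obtain n where "poly R (real n) / 2 ^ n < 1"
    using eventually_happens'[OF sequentially_bot] by blast
  then show ?thesis unfolding R by (intro exI[of _ n]) (simp add: field_simps)
qed


context prob_aut begin

lemma run_count_le_card_accepting_runs:
  assumes "q0 \<in> Q" "\<iota> q0 > 0" "reach q0 x q"
  shows "run_count q w \<le> card (accepting_runs A (x @ w))"
proof -
  have "run_count q w \<le> of_bool (\<iota> q0 > 0) * run_count q0 (x @ w)"
    using assms run_count_reach by simp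
  also have "\<dots> \<le> card (accepting_runs A (x @ w))"
    unfolding card_accepting_runs_eq using assms finite_states by (intro member_le_sum) auto
  finally show ?thesis .
qed

text \<open>Two cycles at \<open>q\<close> over the same word that split at the first letter double
  the runs at each turn. Pumping \<open>n\<close> turns between an access word and an accepting word
  gives at least \<open>2 ^ n\<close> accepting runs on words of length linear in
  \<open>n\<close>.\<close>

lemma no_two_cycles:
  assumes amb: "polynomially_ambiguous A"
    and "q0 \<in> Q" "\<iota> q0 > 0" "x \<in> lists \<Sigma>" "reach q0 x q"
    and "y \<in> lists \<Sigma>" "reach q y f" "f \<in> final A"
    and "q1 \<in> Q" "q2 \<in> Q" "q1 \<noteq> q2" "a \<in> \<Sigma>" "u \<in> lists \<Sigma>"
      "\<delta> q a q1 > 0" "\<delta> q a q2 > 0" "reach q1 u q" "reach q2 u q"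
  shows False
proof -
  obtain P :: "real poly" where P: "\<And>w. w \<in> lists \<Sigma> \<Longrightarrow>
      real (card (accepting_runs A w)) \<le> poly P (real (length w))"
    using amb unfolding polynomially_ambiguous_def by blast
  obtain n where n: "poly P (real ((length x + length y) + Suc (length u) * n)) < 2 ^ n"
    using poly_linear_less_pow2 by blast
  define w where "w = x @ concat (replicate n (a # u)) @ y"
  have w: "w \<in> lists \<Sigma>"
    using assms by (auto simp: w_def split: if_splits)
  have len: "length w = (length x + length y) + Suc (length u) * n"
    by (simp add: w_def length_concat map_replicate sum_list_replicate)
  have "1 \<le> run_count q y"
    using run_count_reach[OF assms(7), of "[]"] assms(8) by (simp add: run_count_def)
  then have "2 ^ n \<le> 2 ^ n * run_count q y" by simp
  also have "\<dots> \<le> run_count q (concat (replicate n (a # u)) @ y)"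
    by (intro run_count_pow run_count_double[where ?q1.0 = q1 and ?q2.0 = q2] assms)
  also have "\<dots> \<le> card (accepting_runs A w)"
    unfolding w_def using assms by (intro run_count_le_card_accepting_runs) auto
  finally have "real (2 ^ n) \<le> real (card (accepting_runs A w))"
    by (simp only: of_nat_le_iff)
  also have "\<dots> \<le> poly P (real (length w))" using P w by blast
  finally show False using n unfolding len by simp
qed

section \<open>Strongly connected components, width and rank\<close>

definition conn :: "'q \<Rightarrow> 'q \<Rightarrow> bool" where
  "conn p q \<longleftrightarrow> (\<exists>v\<in>lists \<Sigma>. reach p v q)"

definition succs :: "'q \<Rightarrow> 'q set" where
  "succs q = {p \<in> Q. conn q p}"

text \<open>The states reached from \<open>q\<close> over \<open>u\<close> within the strongly connected component of \<open>q\<close>.\<close>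

definition post :: "'q \<Rightarrow> 'a list \<Rightarrow> 'q set" where
  "post q u = {p \<in> Q. reach q u p \<and> conn p q}"

text \<open>All prefixes enter, since further letters may merge states or lead out of the component;
  the empty prefix makes the width of a state positive.\<close>

definition width :: "'q \<Rightarrow> 'a list \<Rightarrow> nat" where
  "width q w = (MAX t\<in>{..length w}. card (post q (take t w)))"

text \<open>
  A step out of the component of \<open>q\<close> loses reachable states, which outweighs any change of the width.
\<close>

definition rank :: "'q \<Rightarrow> 'a list \<Rightarrow> nat" where
  "rank q w = card (succs q) * Suc (card Q) + width q w"

lemma conn_refl: "conn q q"
  unfolding conn_def by (rule bexI[of _ "[]"]) auto

lemma conn_trans: "conn p q \<Longrightarrow> conn q r \<Longrightarrow> conn p r"
  unfolding conn_def by (metis append_in_lists_conv reach_append)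

lemma conn_step: "a \<in> \<Sigma> \<Longrightarrow> p \<in> Q \<Longrightarrow> \<delta> q a p > 0 \<Longrightarrow> conn q p"
  unfolding conn_def by (rule bexI[of _ "[a]"]) auto

lemma finite_post: "finite (post q u)" and card_post: "card (post q u) \<le> card Q"
  using finite_states by (auto simp: post_def intro!: card_mono)

lemma finite_succs: "finite (succs q)" and card_succs: "card (succs q) \<le> card Q"
  using finite_states by (auto simp: succs_def intro!: card_mono)

lemma card_post_le_width: "t \<le> length w \<Longrightarrow> card (post q (take t w)) \<le> width q w"
  unfolding width_def by (intro Max_ge) auto

lemma width_attained: "\<exists>t\<le>length w. width q w = card (post q (take t w))"
proof -
  have "width q w \<in> (\<lambda>t. card (post q (take t w))) ` {..length w}"
    unfolding width_def by (intro Max_in) auto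
  then show ?thesis by auto
qed

lemma width_le: "width q w \<le> card Q"
  using width_attained card_post by metis

lemma width_pos: "q \<in> Q \<Longrightarrow> 0 < width q w"
proof -
  assume "q \<in> Q"
  then have "q \<in> post q (take 0 w)" by (simp add: post_def conn_refl)
  then have "0 < card (post q (take 0 w))" using finite_post by (auto simp: card_gt_0_iff)
  also have "\<dots> \<le> width q w" by (rule card_post_le_width) simp
  finally show ?thesis .
qed

lemma rank_le: "rank q w \<le> card Q * (card Q + 2)"
  using mult_right_mono[OF card_succs[of q], of "Suc (card Q)"] width_le[of q w] by (simp add: rank_def algebra_simps)

context
  fixes q a w
  assumes q: "q \<in> Q" and a: "a \<in> \<Sigma>" and w: "w \<in> lists \<Sigma>"
begin

lemma post_step:
  assumes "p \<in> Q" "\<delta> q a p > 0" "conn p q"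
  shows "post p (take t w) \<subseteq> post q (take (Suc t) (a # w))"
  using assms by (auto simp: post_def intro: conn_trans)

lemma rank_step_disconnected:
  assumes "p \<in> Q" "\<delta> q a p > 0" "\<not> conn p q"
  shows "rank p w < rank q (a # w)"
proof -
  have "conn q p" using assms a by (intro conn_step)
  then have "succs p \<subseteq> succs q" by (auto simp: succs_def intro: conn_trans)
  moreover have "q \<in> succs q" "q \<notin> succs p"
    using assms q by (auto simp: succs_def conn_refl)
  ultimately have "succs p \<subset> succs q" by blast
  then have "Suc (card (succs p)) \<le> card (succs q)"
    using finite_succs by (simp add: psubset_card_mono Suc_leI)
  then have "Suc (card (succs p)) * Suc (card Q) \<le> card (succs q) * Suc (card Q)"
    by (rule mult_right_mono) simp
  then show ?thesis using width_le[of p w] by (simp add: rank_def)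
qed

text \<open>What \<open>p\<close> occupies at time \<open>t\<close> lies within what
  \<open>q\<close> occupies one letter later, so a step inside the component cannot increase the
  width.\<close>

lemma width_step:
  assumes "p \<in> Q" "\<delta> q a p > 0" "conn p q"
  shows "width p w \<le> width q (a # w)"
proof -
  obtain t where t: "t \<le> length w" "width p w = card (post p (take t w))"
    using width_attained by blast
  note t(2)
  also have "card (post p (take t w)) \<le> card (post q (take (Suc t) (a # w)))"
    by (intro card_mono finite_post post_step assms)
  also have "\<dots> \<le> width q (a # w)" using t by (intro card_post_le_width) simp
  finally show ?thesis .
qed

lemma rank_step_connected:
  assumes "p \<in> Q" "\<delta> q a p > 0" "conn p q"
  shows "rank p w + width q (a # w) = rank q (a # w) + width p w"
proof -
  have "conn q p" using assms a by (intro conn_step)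
  then have "succs p = succs q" using assms(3) by (auto simp: succs_def intro: conn_trans)
  then show ?thesis by (simp add: rank_def)
qed

lemma rank_step:
  assumes "p \<in> Q" "\<delta> q a p > 0"
  shows "rank p w \<le> rank q (a # w)"
  using rank_step_disconnected[OF assms] rank_step_connected[OF assms] width_step[OF assms] by linarith

text \<open>
  Two successors of the same rank would both attain the width of \<open>q\<close>.  At the earlier of the two
  times at which they do so both are alive and reach disjoint sets of states, so \<open>q\<close> would be wider.
\<close>

lemma rank_step_unique:
  assumes p: "p1 \<in> Q" "p2 \<in> Q" "\<delta> q a p1 > 0" "\<delta> q a p2 > 0" "p1 \<noteq> p2"
    and unamb: "\<And>u. u \<in> lists \<Sigma> \<Longrightarrow> reach p1 u q \<Longrightarrow> reach p2 u q \<Longrightarrow> False"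
    and rank: "rank p1 w = rank q (a # w)" "rank p2 w = rank q (a # w)"
  shows False
proof -
  \<comment> \<open>The case \<open>t1 \<le> t2\<close>; the claim is symmetric in the two
    successors.\<close>
  have *: False if p: "p1 \<in> Q" "p2 \<in> Q" "\<delta> q a p1 > 0" "\<delta> q a p2 > 0" "p1 \<noteq> p2"
    and unamb: "\<And>u. u \<in> lists \<Sigma> \<Longrightarrow> reach p1 u q \<Longrightarrow> reach p2 u q \<Longrightarrow> False"
    and conn: "conn p1 q" "conn p2 q"
    and t1: "t1 \<le> length w" "width q (a # w) = card (post p1 (take t1 w))"
    and t2: "t2 \<le> length w" "width q (a # w) = card (post p2 (take t2 w))" and le: "t1 \<le> t2"
    for p1 p2 t1 t2
  proof -
    have "0 < card (post p2 (take t2 w))" using width_pos[OF q] t2(2) by metis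
    then obtain s where s: "s \<in> post p2 (take t2 w)" by (auto simp: card_gt_0_iff)
    \<comment> \<open>A path to \<open>s\<close> is cut at time \<open>t1\<close>; its state there
      still leads back to \<open>p2\<close>, so \<open>p2\<close> is alive at the earlier
      time.\<close>
    have "take t2 w = take t1 w @ take (t2 - t1) (drop t1 w)"
      using le by (metis le_add_diff_inverse take_add)
    moreover have "take (t2 - t1) (drop t1 w) \<in> lists \<Sigma>"
      using w by (auto dest!: in_set_takeD in_set_dropD)
    ultimately obtain r where "reach p2 (take t1 w) r" "conn r s"
      using s by (auto simp: post_def reach_append conn_def)
    then have "r \<in> post p2 (take t1 w)"
      using s p reach_state by (auto simp: post_def intro: conn_trans)
    then have ne: "0 < card (post p2 (take t1 w))"
      using finite_post by (auto simp: card_gt_0_iff)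
    \<comment> \<open>A common state leads back to \<open>q\<close> and closes two cycles over one
      word, which \<open>unamb\<close> forbids.\<close>
    have disj: "post p1 (take t1 w) \<inter> post p2 (take t1 w) = {}"
    proof (rule ccontr)
      assume "post p1 (take t1 w) \<inter> post p2 (take t1 w) \<noteq> {}"
      then obtain r where r: "reach p1 (take t1 w) r" "reach p2 (take t1 w) r" "conn r p1"
        by (auto simp: post_def)
      then have "conn r q" using conn by (auto intro: conn_trans)
      then obtain v where v: "v \<in> lists \<Sigma>" "reach r v q" by (auto simp: conn_def)
      have "take t1 w @ v \<in> lists \<Sigma>" using v w by (auto dest!: in_set_takeD)
      moreover have "reach p1 (take t1 w @ v) q" "reach p2 (take t1 w @ v) q"
        using r v reach_append by blast+
      ultimately show False using unamb by blast
    qed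
    have "card (post p1 (take t1 w)) + card (post p2 (take t1 w)) =
        card (post p1 (take t1 w) \<union> post p2 (take t1 w))"
      using disj by (simp add: card_Un_disjoint finite_post)
    also have "\<dots> \<le> card (post q (take (Suc t1) (a # w)))"
      by (intro card_mono finite_post Un_least post_step p conn)
    also have "\<dots> \<le> width q (a # w)" using t1 by (intro card_post_le_width) simp
    finally show False using ne t1(2) by simp
  qed
  have conn: "conn p1 q" "conn p2 q"
    using rank_step_disconnected rank p by (metis less_irrefl)+
  have wd: "width p1 w = width q (a # w)" "width p2 w = width q (a # w)"
    using rank_step_connected[OF p(1,3) conn(1)] rank_step_connected[OF p(2,4) conn(2)] rank by simp_all
  obtain t1 t2 where t: "t1 \<le> length w" "width q (a # w) = card (post p1 (take t1 w))"
     "t2 \<le> length w" "width q (a # w) = card (post p2 (take t2 w))"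
    using width_attained wd by metis
  show False
  proof (cases "t1 \<le> t2")
    case True
    then show False using *[of p1 p2 t1 t2] p unamb conn t by blast
  next
    case False
    then show False using *[of p2 p1 t2 t1] p unamb conn t by (metis nat_le_linear)
  qed
qed

end

end

section \<open>Truncation to few random transitions\<close>

lemma power_in_Nats: "x \<in> \<nat> \<Longrightarrow> x ^ k \<in> (\<nat> :: 'a :: semiring_1 set)"
  by (induction k) (auto intro: Nats_mult)

lemma sum_in_Nats: "(\<And>x. x \<in> X \<Longrightarrow> f x \<in> \<nat>) \<Longrightarrow> sum f X \<in> (\<nat> :: 'a :: semiring_1 set)"
  by (induction X rule: infinite_finite_induct) auto

section \<open>Discounted run counts and truncated probabilities\<close>

context prob_aut begin

text \<open>Each run is weighted by \<open>z\<close> to the number of its transitions of probability less than 1.\<close>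

definition discount :: "rat \<Rightarrow> 'q \<Rightarrow> 'a list \<Rightarrow> rat" where
  "discount z = path_sum Q (\<lambda>q a p. if \<delta> q a p > 0 then if \<delta> q a p = 1 then 1 else z else 0)
     (\<lambda>q. of_bool (q \<in> final A))"

lemma discount_Cons: "discount z q (a # w) =
    (\<Sum>p\<in>Q. (if \<delta> q a p > 0 then if \<delta> q a p = 1 then 1 else z else 0) * discount z p w)"
  and discount_Nil: "discount z q [] = of_bool (q \<in> final A)"
  by (simp_all add: discount_def)

lemma discount_nonneg: "0 \<le> z \<Longrightarrow> q \<in> Q \<Longrightarrow> w \<in> lists \<Sigma> \<Longrightarrow> 0 \<le> discount z q w"
  unfolding discount_def by (rule path_sum_nonneg) auto

lemma accept_prob_Cons: "accept_prob q (a # w) = (\<Sum>p\<in>Q. \<delta> q a p * accept_prob p w)"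
  and accept_prob_Nil: "accept_prob q [] = of_bool (q \<in> final A)"
  by (simp_all add: accept_prob_def)

lemma accept_prob_nonneg: "q \<in> Q \<Longrightarrow> w \<in> lists \<Sigma> \<Longrightarrow> 0 \<le> accept_prob q w"
  unfolding accept_prob_def by (rule path_sum_nonneg) (auto simp: trans_nonneg)

lemma accept_prob_le_1:
  assumes "q \<in> Q" "w \<in> lists \<Sigma>" shows "accept_prob q w \<le> 1"
  using assms(2,1)
proof (induction arbitrary: q)
  case Nil
  then show ?case by (simp add: accept_prob_Nil)
next
  case (Cons a w)
  have "accept_prob q (a # w) \<le> (\<Sum>p\<in>Q. \<delta> q a p * 1)"
    unfolding accept_prob_Cons using Cons by (intro sum_mono mult_left_mono) (auto simp: trans_nonneg)
  also have "\<dots> \<le> 1" using Cons trans_sum by simp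
  finally show ?case .
qed

text \<open>A nonzero discount supplies the accepting continuation that \<open>no_two_cycles\<close>
  asks for; where it vanishes, the bound is immediate.\<close>

lemma discount_nonzero_reach:
  "discount z q w \<noteq> 0 \<Longrightarrow> \<exists>f\<in>final A. reach q w f"
proof (induction w arbitrary: q)
  case (Cons a w)
  then obtain p where "p \<in> Q" "(if \<delta> q a p > 0 then if \<delta> q a p = 1 then 1 else z else 0) * discount z p w \<noteq> 0"
    unfolding discount_Cons by (metis (no_types, lifting) sum.neutral)
  then have "p \<in> Q" "\<delta> q a p > 0" "discount z p w \<noteq> 0" by (auto split: if_splits)
  then show ?case using Cons.IH[of p] by auto
qed (auto simp: discount_Nil)

lemma discount_deterministic:
  assumes "q \<in> Q" "a \<in> \<Sigma>" "p \<in> Q" "\<delta> q a p = 1"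
  shows "discount z q (a # w) = discount z p w"
proof -
  have "discount z q (a # w) = (\<Sum>r\<in>Q. if r = p then discount z p w else 0)"
    unfolding discount_Cons using assms trans_one_unique[OF assms(1-3) _ assms(4)]
    by (intro sum.cong) auto
  then show ?thesis using assms finite_states by simp
qed

text \<open>At a random step at most one successor keeps the rank \<open>r\<close>, and the others
  have rank at most \<open>r - 1\<close>. Hence the sum is at most
  \<open>z * (G ^ r + card Q * G ^ (r - 1))\<close>, and the condition on \<open>G\<close> makes the
  second term fit into \<open>(1 - z) * G ^ r\<close>. The access word \<open>x\<close> is carried
  along to invoke \<open>no_two_cycles\<close>.\<close>

lemma discount_le:
  assumes amb: "polynomially_ambiguous A"
    and z: "0 \<le> z" "z < 1" and G: "1 \<le> G" "of_nat (card Q) \<le> (1 - z) * G"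
    and "q0 \<in> Q" "\<iota> q0 > 0" "x \<in> lists \<Sigma>" "reach q0 x q"
    and "w \<in> lists \<Sigma>"
  shows "discount z q w \<le> G ^ rank q w"
  using assms(10,8,9)
proof (induction arbitrary: q x)
  case Nil
  have "1 \<le> G ^ rank q []" using G(1) by (rule one_le_power)
  then show ?case by (simp add: discount_Nil)
next
  case (Cons a w)
  have q: "q \<in> Q" using Cons.prems assms(6) reach_state by blast
  have IH: "discount z p w \<le> G ^ rank p w" if "p \<in> Q" "\<delta> q a p > 0" for p
    using that Cons.hyps Cons.prems by (intro Cons.IH[of "x @ [a]"]) (auto simp: reach_append)
  have step: "rank p w \<le> rank q (a # w)" if "p \<in> Q" "\<delta> q a p > 0" for p
    using rank_step q Cons.hyps that by blast
  consider (zero) "discount z q (a # w) = 0" | (det) p where "p \<in> Q" "\<delta> q a p = 1"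
    | (branch) "discount z q (a # w) \<noteq> 0" "\<And>p. p \<in> Q \<Longrightarrow> \<delta> q a p \<noteq> 1" by blast
  then show ?case
  proof cases
    case zero
    then show ?thesis using G by simp
  next
    case det
    then have "discount z q (a # w) \<le> G ^ rank p w"
      using discount_deterministic[OF q Cons.hyps(1)] IH by simp
    also have "\<dots> \<le> G ^ rank q (a # w)" using step[of p] det G by (intro power_increasing) auto
    finally show ?thesis .
  next
    case branch
    define P where "P = {p \<in> Q. \<delta> q a p > 0}"
    define r where "r = rank q (a # w)"
    \<comment> \<open>The width is positive, hence so is the rank, and \<open>r - 1\<close> is a
      true predecessor.\<close>
    have r: "r = Suc (r - 1)" using width_pos[OF q, of "a # w"] by (simp add: r_def rank_def)
    have fin: "finite P" "card P \<le> card Q" using finite_states by (auto simp: P_def intro: card_mono)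
    obtain f where f: "f \<in> final A" "reach q (a # w) f"
      using discount_nonzero_reach[OF branch(1)] by blast
    have uniq: "p1 = p2" if p: "p1 \<in> P" "p2 \<in> P" "rank p1 w = r" "rank p2 w = r" for p1 p2
    proof (rule ccontr)
      assume ne: "p1 \<noteq> p2"
      show False
      proof (rule rank_step_unique[OF q Cons.hyps(1,2), of p1 p2])
        show False if "u \<in> lists \<Sigma>" "reach p1 u q" "reach p2 u q" for u
          using that p ne Cons.hyps Cons.prems assms f
          by (intro no_two_cycles[OF amb, of q0 x q "a # w" f p1 p2 a u]) (auto simp: P_def)
      qed (use p ne in \<open>auto simp: P_def r_def\<close>)
    qed
    have "card {p \<in> P. rank p w = r} \<le> 1"
      using uniq fin by (simp add: card_le_Suc0_iff_eq)
    have "discount z q (a # w) = (\<Sum>p\<in>P. z * discount z p w)"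
      unfolding discount_Cons using branch(2) finite_states
      by (intro sum.mono_neutral_cong_right) (auto simp: P_def)
    also have "\<dots> = z * (\<Sum>p\<in>P. discount z p w)" by (simp add: sum_distrib_left)
    also have "\<dots> \<le> z * (G ^ r + of_nat (card Q) * G ^ (r - 1))"
    proof (intro mult_left_mono z)
      have "(\<Sum>p\<in>P. discount z p w) \<le> (\<Sum>p\<in>P. (if rank p w = r then G ^ r else 0) + G ^ (r - 1))"
      proof (rule sum_mono)
        fix p assume p: "p \<in> P"
        then have "discount z p w \<le> G ^ rank p w" using IH by (simp add: P_def)
        moreover have "G ^ rank p w \<le> G ^ (r - 1)" if "rank p w \<noteq> r"
          using step[of p] p that G by (intro power_increasing) (auto simp: P_def r_def)
        ultimately show "discount z p w \<le> (if rank p w = r then G ^ r else 0) + G ^ (r - 1)"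
          using G by (cases "rank p w = r") (auto simp: add_increasing2)
      qed
      also have "\<dots> = of_nat (card {p \<in> P. rank p w = r}) * G ^ r + of_nat (card P) * G ^ (r - 1)"
        using fin by (simp add: sum.distrib sum.If_cases Int_def)
      also have "\<dots> \<le> 1 * G ^ r + of_nat (card Q) * G ^ (r - 1)"
        using \<open>card {p \<in> P. rank p w = r} \<le> 1\<close> fin G
        by (intro add_mono mult_right_mono) auto
      finally show "(\<Sum>p\<in>P. discount z p w) \<le> G ^ r + of_nat (card Q) * G ^ (r - 1)" by simp
    qed
    \<comment> \<open>The factor \<open>z\<close> is kept on the leading term and bounded by 1 on
      the other.\<close>
    also have "\<dots> \<le> z * G ^ r + 1 * (of_nat (card Q) * G ^ (r - 1))"
      unfolding distrib_left using z G by (intro add_left_mono mult_right_mono) auto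
    also have "\<dots> \<le> z * G ^ r + (1 - z) * G * G ^ (r - 1)"
      using G by (intro add_mono) (auto intro: mult_right_mono)
    also have "\<dots> = z * G ^ r + (1 - z) * G ^ Suc (r - 1)" by simp
    also have "\<dots> = G ^ r" using r by (simp add: algebra_simps)
    finally show ?thesis by (simp add: r_def)
  qed
qed

text \<open>The acceptance probability along runs with at most \<open>k\<close> transitions of probability less than 1.\<close>

fun trunc_prob :: "nat \<Rightarrow> 'q \<Rightarrow> 'a list \<Rightarrow> rat" where
  "trunc_prob k q [] = of_bool (q \<in> final A)"
| "trunc_prob k q (a # w) = (\<Sum>p\<in>Q. \<delta> q a p * (if \<delta> q a p = 1 then trunc_prob k p w
     else if k = 0 then 0 else trunc_prob (k - 1) p w))"

lemma trunc_prob_nonneg: "q \<in> Q \<Longrightarrow> w \<in> lists \<Sigma> \<Longrightarrow> 0 \<le> trunc_prob k q w"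
proof (induction w arbitrary: k q)
  case (Cons a w)
  then show ?case by (auto intro!: sum_nonneg mult_nonneg_nonneg trans_nonneg)
qed simp

lemma trunc_prob_le: "q \<in> Q \<Longrightarrow> w \<in> lists \<Sigma> \<Longrightarrow> trunc_prob k q w \<le> accept_prob q w"
proof (induction w arbitrary: k q)
  case Nil
  then show ?case by (simp add: accept_prob_Nil)
next
  case (Cons a w)
  then show ?case unfolding accept_prob_Cons trunc_prob.simps
    by (intro sum_mono mult_left_mono) (auto intro: trans_nonneg accept_prob_nonneg)
qed

text \<open>Only a transition of probability less than 1 costs a factor \<open>D\<close>, and at
  most \<open>k\<close> of these occur in a counted run.\<close>

lemma trunc_prob_Nats:
  assumes D: "\<And>q a p. q \<in> Q \<Longrightarrow> a \<in> \<Sigma> \<Longrightarrow> p \<in> Q \<Longrightarrow> \<delta> q a p * of_nat D \<in> \<nat>"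
  shows "q \<in> Q \<Longrightarrow> w \<in> lists \<Sigma> \<Longrightarrow> trunc_prob k q w * of_nat D ^ k \<in> \<nat>"
proof (induction w arbitrary: k q)
  case Nil
  then show ?case by (auto intro: Nats_mult power_in_Nats)
next
  case (Cons a w)
  have "\<delta> q a p * (if \<delta> q a p = 1 then trunc_prob k p w
     else if k = 0 then 0 else trunc_prob (k - 1) p w) * of_nat D ^ k \<in> \<nat>" if p: "p \<in> Q" for p
  proof (cases "\<delta> q a p = 1 \<or> k = 0")
    case True
    then show ?thesis using Cons p by auto
  next
    case False
    then obtain j where j: "k = Suc j" using not0_implies_Suc by blast
    have "(\<delta> q a p * of_nat D) * (trunc_prob j p w * of_nat D ^ j) \<in> \<nat>"
    proof (rule Nats_mult)
      show "\<delta> q a p * of_nat D \<in> \<nat>" using Cons.prems p by (intro D) auto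
      show "trunc_prob j p w * of_nat D ^ j \<in> \<nat>" using Cons.IH[of p j] Cons.prems p by simp
    qed
    then show ?thesis using False j by (simp add: mult_ac)
  qed
  then show ?case by (auto simp: sum_distrib_right simp del: of_nat_power intro!: sum_in_Nats)
qed

lemma discount_ge_accept_prob:
  assumes z: "\<And>q a p. q \<in> Q \<Longrightarrow> a \<in> \<Sigma> \<Longrightarrow> p \<in> Q \<Longrightarrow> \<delta> q a p \<noteq> 1 \<Longrightarrow> \<delta> q a p \<le> z"
    and "0 \<le> z" and "q \<in> Q" "w \<in> lists \<Sigma>"
  shows "accept_prob q w \<le> discount z q w"
  using assms(4,3)
proof (induction arbitrary: q)
  case Nil
  then show ?case by (simp add: accept_prob_Nil discount_Nil)
next
  case (Cons a w)
  show ?case unfolding accept_prob_Cons discount_Cons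
  proof (rule sum_mono)
    fix p assume p: "p \<in> Q"
    show "\<delta> q a p * accept_prob p w \<le>
        (if \<delta> q a p > 0 then if \<delta> q a p = 1 then 1 else z else 0) * discount z p w"
      using Cons p z[of q a p] trans_nonneg[of q a p] accept_prob_nonneg[of p w] \<open>0 \<le> z\<close>
      by (intro mult_mono) auto
  qed
qed

text \<open>Omitted runs have more than \<open>k\<close> random transitions, each of probability at
  most \<open>z * z\<close>. One factor \<open>z\<close> of each yields \<open>z ^ k\<close>, and
  the other one is the discount weight.\<close>

lemma accept_prob_minus_trunc_le:
  assumes z: "\<And>q a p. q \<in> Q \<Longrightarrow> a \<in> \<Sigma> \<Longrightarrow> p \<in> Q \<Longrightarrow> \<delta> q a p \<noteq> 1 \<Longrightarrow> \<delta> q a p \<le> z * z"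
    and z0: "0 \<le> z" "z \<le> 1" and "q \<in> Q" "w \<in> lists \<Sigma>"
  shows "accept_prob q w - trunc_prob k q w \<le> z ^ k * discount z q w"
  using assms(5,4)
proof (induction arbitrary: q k)
  case Nil
  then show ?case using z0 by (simp add: accept_prob_Nil discount_Nil)
next
  case (Cons a w)
  have "z * z \<le> z" using z0 by (simp add: mult_left_le)
  then have z': "\<delta> q a p \<le> z" if "q \<in> Q" "a \<in> \<Sigma>" "p \<in> Q" "\<delta> q a p \<noteq> 1" for q a p
    using z that by (meson order_trans)
  show ?case unfolding accept_prob_Cons discount_Cons trunc_prob.simps sum_subtractf[symmetric] sum_distrib_left
  proof (rule sum_mono)
    fix p assume p: "p \<in> Q"
    let ?d = "\<delta> q a p" and ?S = "discount z p w"
    have d: "0 \<le> ?d" using Cons p by (auto intro: trans_nonneg)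
    have S: "0 \<le> ?S" using Cons p z0 by (auto intro: discount_nonneg)
    have V: "0 \<le> accept_prob p w" "accept_prob p w \<le> ?S"
      using Cons p z0 z' by (auto intro: accept_prob_nonneg discount_ge_accept_prob)
    show "?d * accept_prob p w - ?d * (if ?d = 1 then trunc_prob k p w
        else if k = 0 then 0 else trunc_prob (k - 1) p w)
      \<le> z ^ k * ((if ?d > 0 then if ?d = 1 then 1 else z else 0) * ?S)"
    proof (cases "?d = 0 \<or> ?d = 1")
      case True
      then show ?thesis using Cons.IH[OF p, of k] by auto
    next
      case False
      show ?thesis
      proof (cases k)
        case 0
        have "?d * accept_prob p w \<le> z * ?S"
          using False Cons p d V z'[of q a p] z0 by (intro mult_mono) auto
        then show ?thesis using False d 0 by auto
      next
        case (Suc j)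
        have "?d * (accept_prob p w - trunc_prob j p w) \<le> ?d * (z ^ j * ?S)"
          using Cons.IH[OF p, of j] d by (rule mult_left_mono)
        also have "\<dots> \<le> (z * z) * (z ^ j * ?S)"
          using False Cons p z[of q a p] S z0 by (intro mult_right_mono) auto
        finally show ?thesis using False d Suc by (auto simp: algebra_simps)
      qed
    qed
  qed
qed

section \<open>Words with equal truncated probabilities\<close>

definition trunc_vector :: "nat \<Rightarrow> 'a list \<Rightarrow> nat \<times> 'q \<Rightarrow> rat" where
  "trunc_vector K w = restrict (\<lambda>(k, q). trunc_prob k q w) ({..K} \<times> Q)"

lemma trunc_vector_eqD:
  "trunc_vector K v = trunc_vector K w \<Longrightarrow> k \<le> K \<Longrightarrow> q \<in> Q \<Longrightarrow> trunc_prob k q v = trunc_prob k q w"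
  by (drule fun_cong[of _ _ "(k, q)"]) (simp add: trunc_vector_def)

text \<open>Prepending a letter computes level \<open>k\<close> from levels \<open>k\<close> and
  \<open>k - 1\<close> of the remaining word alone; keeping all levels up to \<open>K\<close>
  therefore makes equality of vectors a left congruence.\<close>

lemma trunc_vector_append:
  assumes "trunc_vector K v = trunc_vector K w"
  shows "trunc_vector K (u @ v) = trunc_vector K (u @ w)"
proof (induction u)
  case Nil
  then show ?case using assms by simp
next
  case (Cons a u)
  have "trunc_prob k q (a # u @ v) = trunc_prob k q (a # u @ w)" if "k \<le> K" "q \<in> Q" for k q
    using trunc_vector_eqD[OF Cons] that by (auto intro!: sum.cong)
  then show ?case by (auto simp: trunc_vector_def restrict_def fun_eq_iff)
qed

text \<open>Cutting the vector off outside its index set places it in a finite set of extensional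
  functions, which is what the pigeonhole argument counts.\<close>

lemma trunc_vector_range:
  assumes D: "\<And>q a p. q \<in> Q \<Longrightarrow> a \<in> \<Sigma> \<Longrightarrow> p \<in> Q \<Longrightarrow> \<delta> q a p * of_nat D \<in> \<nat>" "0 < D"
    and w: "w \<in> lists \<Sigma>"
  shows "trunc_vector K w \<in> ({..K} \<times> Q) \<rightarrow>\<^sub>E (\<lambda>j. of_nat j / of_nat (D ^ K)) ` {..D ^ K}"
proof (rule PiE_I)
  fix kq assume "kq \<in> {..K} \<times> Q"
  then obtain k q where kq: "kq = (k, q)" "k \<le> K" "q \<in> Q" by auto
  \<comment> \<open>Level \<open>k\<close> only needs the denominator \<open>D ^ k\<close>; the
    missing power makes \<open>D ^ K\<close> common to all levels.\<close>
  have "trunc_prob k q w * of_nat D ^ k * of_nat D ^ (K - k) \<in> \<nat>"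
    using trunc_prob_Nats[OF D(1) kq(3) w, of k] by (rule Nats_mult) (simp_all add: power_in_Nats)
  also have "trunc_prob k q w * of_nat D ^ k * of_nat D ^ (K - k) = trunc_prob k q w * of_nat (D ^ K)"
    using kq(2) by (simp add: mult.assoc flip: power_add)
  finally obtain j where j: "trunc_prob k q w * of_nat (D ^ K) = of_nat j" by (auto elim: Nats_cases)
  have "trunc_prob k q w \<le> 1"
    using trunc_prob_le[OF kq(3) w] accept_prob_le_1[OF kq(3) w] by (meson order_trans)
  then have "of_nat j \<le> (of_nat (D ^ K) :: rat)"
    unfolding j[symmetric] by (intro mult_left_le_one_le) (use trunc_prob_nonneg[OF kq(3) w] in auto)
  then have "j \<le> D ^ K" by (simp only: of_nat_le_iff)
  moreover have "trunc_prob k q w = of_nat j / of_nat (D ^ K)"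
    using D(2) by (simp add: field_simps flip: j)
  ultimately show "trunc_vector K w kq \<in> (\<lambda>j. of_nat j / of_nat (D ^ K)) ` {..D ^ K}"
    using kq by (auto simp: trunc_vector_def)
qed (auto simp: trunc_vector_def)

text \<open>A word at least as long as the number of possible vectors has two suffixes with the same
  vector. Deleting the factor between their starting points keeps the vector of the whole word, and
  induction on the length applies.\<close>

lemma short_word:
  assumes D: "\<And>q a p. q \<in> Q \<Longrightarrow> a \<in> \<Sigma> \<Longrightarrow> p \<in> Q \<Longrightarrow> \<delta> q a p * of_nat D \<in> \<nat>" "0 < D"
    and w: "w \<in> lists \<Sigma>"
  shows "\<exists>v\<in>lists \<Sigma>. length v < Suc (D ^ K) ^ (Suc K * card Q) \<and> trunc_vector K v = trunc_vector K w"
  using w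
proof (induction "length w" arbitrary: w rule: less_induct)
  case less
  let ?B = "Suc (D ^ K) ^ (Suc K * card Q)"
  let ?X = "({..K} \<times> Q) \<rightarrow>\<^sub>E (\<lambda>j. of_nat j / of_nat (D ^ K) :: rat) ` {..D ^ K}"
  show ?case
  proof (cases "length w < ?B")
    case False
    have "card ?X = card ((\<lambda>j. of_nat j / of_nat (D ^ K) :: rat) ` {..D ^ K}) ^ (Suc K * card Q)"
      using finite_states by (simp add: card_PiE)
    also have "\<dots> \<le> ?B"
      by (intro power_mono) (use card_image_le[of "{..D ^ K}"] in auto)
    \<comment> \<open>A word has one suffix more than it has letters, the empty one
      included.\<close>
    finally have "card ?X < card {..length w}" using False by simp
    moreover have "finite ?X" using finite_states by (intro finite_PiE) auto
    moreover have sub: "(\<lambda>i. trunc_vector K (drop i w)) ` {..length w} \<subseteq> ?X"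
      using less(2) by (intro image_subsetI trunc_vector_range D) (auto dest: in_set_dropD)
    ultimately have "\<not> inj_on (\<lambda>i. trunc_vector K (drop i w)) {..length w}"
      using card_inj_on_le[OF _ sub] by (meson linorder_not_less)
    then obtain i j where "i \<noteq> j" "i \<le> length w" "j \<le> length w"
        "trunc_vector K (drop i w) = trunc_vector K (drop j w)"
      by (auto simp: inj_on_def)
    then obtain i j where ij: "i < j" "i \<le> length w" "j \<le> length w"
        "trunc_vector K (drop i w) = trunc_vector K (drop j w)"
      by (metis nat_neq_iff)
    define w' where "w' = take i w @ drop j w"
    have "trunc_vector K w' = trunc_vector K (take i w @ drop i w)"
      unfolding w'_def by (rule trunc_vector_append) (simp add: ij)
    then have eq: "trunc_vector K w' = trunc_vector K w" by simp
    have "w' \<in> lists \<Sigma>" "length w' < length w"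
      using less(2) ij by (auto simp: w'_def dest!: in_set_takeD in_set_dropD)
    then show ?thesis using less(1) eq by metis
  qed (use less in blast)
qed

end

text \<open>A form of Bernoulli's inequality: it bounds \<open>z ^ k\<close> by the reciprocal of a
  linear function of \<open>k\<close>. This rate is slow but gives an explicit \<open>K\<close> in
  rational arithmetic.\<close>

lemma power_times_bernoulli_le:
  fixes z :: "'a :: linordered_field"
  assumes "0 \<le> z" "z \<le> 1"
  shows "z ^ k * (1 + of_nat k * (1 - z)) \<le> 1"
proof (induction k)
  case (Suc k)
  have "z * (1 + of_nat (Suc k) * (1 - z)) \<le> 1 + of_nat k * (1 - z)"
  proof -
    have "1 + of_nat k * (1 - z) - z * (1 + of_nat (Suc k) * (1 - z)) = of_nat (Suc k) * (1 - z) * (1 - z)"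
      by (simp add: algebra_simps)
    also have "\<dots> \<ge> 0" using assms by (intro mult_nonneg_nonneg) auto
    finally show ?thesis by simp
  qed
  then have "z ^ k * (z * (1 + of_nat (Suc k) * (1 - z))) \<le> z ^ k * (1 + of_nat k * (1 - z))"
    using assms by (intro mult_left_mono) auto
  then have "z ^ k * (z * (1 + of_nat (Suc k) * (1 - z))) \<le> 1" using Suc by (rule order_trans)
  then show ?case by (simp only: power_Suc2 mult.assoc)
qed simp

text \<open>
  With \<open>z = 1 - 1 / (2 * D)\<close> and \<open>G = 2 * D * n\<close>, the discounted number of runs is at most
  \<open>G ^ (n * (n + 2))\<close>, and \<open>z ^ trunc_bound D n\<close> times this is at most \<open>1 / n\<close>.
\<close>

definition trunc_bound :: "nat \<Rightarrow> nat \<Rightarrow> nat" where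
  "trunc_bound D n = 2 * D * (2 * D * n) ^ (n * (n + 2)) * n"

text \<open>The length bound of \<open>short_word\<close> for \<open>K = trunc_bound D n\<close>,
  with \<open>n\<close> standing in for the number of states.\<close>

definition word_bound :: "nat \<Rightarrow> nat \<Rightarrow> nat" where
  "word_bound D n = Suc (D ^ trunc_bound D n) ^ (Suc (trunc_bound D n) * n)"

context prob_aut begin

text \<open>Replacing \<open>accept_prob\<close> by \<open>trunc_prob\<close> loses at most
  \<open>\<epsilon>\<close> at \<open>w\<close>. The short word \<open>v\<close> has the same
  truncated values, and these are lower bounds for its acceptance probabilities, so nothing is lost
  there.\<close>

lemma gap_short_word:
  assumes amb: "polynomially_ambiguous A"
    and D: "\<And>q a p. q \<in> Q \<Longrightarrow> a \<in> \<Sigma> \<Longrightarrow> p \<in> Q \<Longrightarrow> \<delta> q a p * of_nat D \<in> \<nat>" "0 < D"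
    and n: "card Q \<le> n" "0 < n" "1 / of_nat n \<le> \<epsilon>"
    and w: "w \<in> lists \<Sigma>" "word_prob A w > 1 / 2 + \<epsilon>"
  shows "\<exists>v\<in>lists \<Sigma>. length v < word_bound D n \<and> word_prob A v > 1 / 2"
proof -
  define z :: rat where "z = 1 - 1 / (2 * of_nat D)"
  define G :: rat where "G = of_nat (2 * D * n)"
  define H where "H = G ^ (n * (n + 2))"
  define K where "K = trunc_bound D n"
  have D1: "1 \<le> (of_nat D :: rat)" using D(2) by (cases D) simp_all
  have z: "0 \<le> z" "z < 1" "(1 - z) * (2 * of_nat D) = 1"
    using D1 by (auto simp: z_def field_simps)
  have n1: "1 \<le> (of_nat n :: rat)" using n(2) by (cases n) simp_all
  have G1: "1 \<le> G"
  proof -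
    have "1 \<le> 2 * D * n" using D(2) n(2) by (simp add: Suc_leI)
    then have "of_nat 1 \<le> (of_nat (2 * D * n) :: rat)" by (simp only: of_nat_le_iff)
    then show ?thesis by (simp add: G_def)
  qed
  have "(1 - z) * G = (1 - z) * (2 * of_nat D) * of_nat n" by (simp add: G_def)
  then have zG: "(1 - z) * G = of_nat n" by (simp add: z)
  \<comment> \<open>A probability other than 1 is at most \<open>1 - 1 / D\<close>, being a multiple
    of \<open>1 / D\<close>. Since \<open>z * z = 1 - 1 / D + 1 / (4 * D ^ 2)\<close>, this
    \<open>z\<close> lies above its square root.\<close>
  have zz: "\<delta> q a p \<le> z * z" if qap: "q \<in> Q" "a \<in> \<Sigma>" "p \<in> Q" "\<delta> q a p \<noteq> 1" for q a p
  proof -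
    obtain j where j: "\<delta> q a p * of_nat D = of_nat j" using Nats_cases[OF D(1)[OF qap(1-3)]] by metis
    have "\<delta> q a p = (\<Sum>p\<in>{p}. \<delta> q a p)" by simp
    also have "\<dots> \<le> (\<Sum>p\<in>Q. \<delta> q a p)"
      using qap finite_states by (intro sum_mono2) (auto simp: trans_nonneg)
    finally have "\<delta> q a p < 1" using qap trans_sum[of q a] by simp
    then have "of_nat j < (of_nat D :: rat)" unfolding j[symmetric] using D(2) by simp
    then have "j + 1 \<le> D" by simp
    then have "of_nat (j + 1) \<le> (of_nat D :: rat)" by (simp only: of_nat_le_iff)
    then have "\<delta> q a p * of_nat D + 1 \<le> of_nat D" by (simp add: j)
    then have "\<delta> q a p \<le> 1 - 1 / of_nat D" using D1 by (simp add: field_simps)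
    also have "\<dots> \<le> 1 - 1 / of_nat D + (1 / (2 * of_nat D)) * (1 / (2 * of_nat D))" by simp
    also have "\<dots> = z * z" using D1 by (simp add: z_def field_simps)
    finally show ?thesis .
  qed
  have "z ^ K * (1 + of_nat K * (1 - z)) \<le> 1" using z by (intro power_times_bernoulli_le) auto
  \<comment> \<open>The factor \<open>2 * D\<close> in \<open>trunc_bound\<close> cancels
    \<open>1 - z\<close>, which leaves \<open>H * n\<close>.\<close>
  also have "of_nat K * (1 - z) = H * of_nat n * ((1 - z) * (2 * of_nat D))"
    by (simp add: K_def trunc_bound_def H_def G_def mult_ac)
  finally have "z ^ K * (1 + H * of_nat n) \<le> 1" by (simp add: z)
  moreover have "z ^ K * (H * of_nat n) \<le> z ^ K * (1 + H * of_nat n)"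
    using z by (intro mult_left_mono) auto
  ultimately have "z ^ K * H * of_nat n \<le> 1" by (simp add: mult.assoc)
  then have "z ^ K * H \<le> 1 / of_nat n" using n1 by (simp add: pos_le_divide_eq)
  then have tail: "z ^ K * H \<le> \<epsilon>" using n(3) by (rule order_trans)
  have close: "\<iota> q * accept_prob q w \<le> \<iota> q * (trunc_prob K q w + \<epsilon>)" if q: "q \<in> Q" for q
  proof (cases "\<iota> q = 0")
    case False
    then have pos: "\<iota> q > 0" using init_nonneg[OF q] by simp
    have "discount z q w \<le> G ^ rank q w"
    proof (rule discount_le[OF amb z(1,2) G1 _ q pos, where x = "[]"])
      show "of_nat (card Q) \<le> (1 - z) * G" using n(1) by (simp add: zG)
    qed (use w in auto)
    also have "rank q w \<le> n * (n + 2)"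
      using rank_le[of q w] mult_mono[OF n(1), of "card Q + 2" "n + 2"] n(1) by linarith
    then have "G ^ rank q w \<le> H" unfolding H_def using G1 by (rule power_increasing)
    finally have "z ^ K * discount z q w \<le> z ^ K * H" using z by (intro mult_left_mono) auto
    then have "accept_prob q w \<le> trunc_prob K q w + \<epsilon>"
      using accept_prob_minus_trunc_le[OF zz, of q w K] q w z tail by auto
    then show ?thesis using pos by simp
  qed simp
  obtain v where v: "v \<in> lists \<Sigma>" "length v < Suc (D ^ K) ^ (Suc K * card Q)"
      "trunc_vector K v = trunc_vector K w"
    using short_word[OF D w(1)] by blast
  have "0 < \<epsilon>" using n1 n(3) by (meson divide_pos_pos less_le_trans zero_less_one)
  have "1 / 2 + \<epsilon> < (\<Sum>q\<in>Q. \<iota> q * accept_prob q w)" using w word_prob_eq by simp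
  also have "\<dots> \<le> (\<Sum>q\<in>Q. \<iota> q * (trunc_prob K q w + \<epsilon>))" by (intro sum_mono close)
  also have "\<dots> = (\<Sum>q\<in>Q. \<iota> q * trunc_prob K q w) + (\<Sum>q\<in>Q. \<iota> q) * \<epsilon>"
    by (simp add: algebra_simps sum.distrib sum_distrib_left)
  also have "\<dots> \<le> (\<Sum>q\<in>Q. \<iota> q * trunc_prob K q w) + 1 * \<epsilon>"
    using init_sum \<open>0 < \<epsilon>\<close> by (intro add_left_mono mult_right_mono) auto
  finally have "1 / 2 < (\<Sum>q\<in>Q. \<iota> q * trunc_prob K q w)" by simp
  also have "\<dots> = (\<Sum>q\<in>Q. \<iota> q * trunc_prob K q v)"
    using trunc_vector_eqD[OF v(3)] by simp
  also have "\<dots> \<le> (\<Sum>q\<in>Q. \<iota> q * accept_prob q v)"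
    using v init_nonneg trunc_prob_le by (intro sum_mono mult_left_mono) auto
  also have "\<dots> = word_prob A v" using v word_prob_eq by simp
  finally have "1 / 2 < word_prob A v" .
  moreover have "length v < word_bound D n"
  proof -
    have "Suc (D ^ K) ^ (Suc K * card Q) \<le> Suc (D ^ K) ^ (Suc K * n)"
      using n(1) by (intro power_increasing mult_left_mono) auto
    with v(2) show ?thesis by (simp only: word_bound_def K_def)
  qed
  ultimately show ?thesis using v by blast
qed

end

section \<open>The decision procedure\<close>

definition digit :: "nat \<Rightarrow> nat \<Rightarrow> nat \<Rightarrow> nat" where
  "digit b u i = u div b ^ i mod b"

lemma digit_inject:
  assumes "r < b ^ l" "s < b ^ l" "\<And>i. i < l \<Longrightarrow> digit b r i = digit b s i"
  shows "r = s"
  using assms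
proof (induction l arbitrary: r s)
  case (Suc l)
  have shift: "digit b (r div b) i = digit b r (Suc i)" for r i
    by (simp add: digit_def div_mult2_eq)
  have "r div b < b ^ l" "s div b < b ^ l"
    using Suc.prems by (auto simp: less_mult_imp_div_less mult.commute)
  then have "r div b = s div b"
  proof (rule Suc.IH)
    show "digit b (r div b) i = digit b (s div b) i" if "i < l" for i
      using Suc.prems(3)[of "Suc i"] that by (simp add: shift)
  qed
  moreover have "r mod b = s mod b"
    using Suc.prems(3)[of 0] by (simp add: digit_def)
  ultimately have "r div b * b + r mod b = s div b * b + s mod b" by simp
  then show ?case by (simp only: div_mult_mod_eq)
qed simp

text \<open>Distinct numbers below \<open>length qs ^ l\<close> have distinct digit sequences;
  equality of the finite cardinalities then gives surjectivity.\<close>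

lemma bij_betw_digits:
  assumes "distinct qs"
  shows "bij_betw (\<lambda>r. map (\<lambda>i. qs ! digit (length qs) r i) [0..<l])
    {..<length qs ^ l} {xs. length xs = l \<and> set xs \<subseteq> set qs}"
proof -
  let ?m = "length qs"
  let ?f = "\<lambda>r. map (\<lambda>i. qs ! digit ?m r i) [0..<l]"
  let ?X = "{xs. length xs = l \<and> set xs \<subseteq> set qs}"
  have digit_less: "digit ?m r i < ?m" if "i < l" "r < ?m ^ l" for r i
  proof -
    \<comment> \<open>For empty \<open>qs\<close> only \<open>l = 0\<close> leaves a number in
      range, and then no index exists.\<close>
    have "?m \<noteq> 0" using that by (cases "?m = 0") (auto simp: power_0_left)
    then show ?thesis by (simp add: digit_def)
  qed
  have inj: "inj_on ?f {..<?m ^ l}"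
  proof (rule inj_onI)
    fix r s assume rs: "r \<in> {..<?m ^ l}" "s \<in> {..<?m ^ l}" "?f r = ?f s"
    then have "qs ! digit ?m r i = qs ! digit ?m s i" if "i < l" for i
      using that by (auto simp: map_eq_conv)
    then have "digit ?m r i = digit ?m s i" if "i < l" for i
      using that rs digit_less assms by (auto simp: nth_eq_iff_index_eq)
    then show "r = s" using rs by (intro digit_inject[of r ?m l s]) auto
  qed
  have "?f ` {..<?m ^ l} = ?X"
  proof (rule card_subset_eq)
    have eq: "?X = {xs. set xs \<subseteq> set qs \<and> length xs = l}" by auto
    show "finite ?X" unfolding eq by (rule finite_lists_length_eq) simp
    show "?f ` {..<?m ^ l} \<subseteq> ?X" using digit_less by (auto intro!: nth_mem)
    show "card (?f ` {..<?m ^ l}) = card ?X"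
      unfolding card_image[OF inj] eq by (simp add: card_lists_length_eq distinct_card assms)
  qed
  with inj show ?thesis by (simp add: bij_betw_def)
qed

lemma nth_concat_map:
  assumes "\<And>x. x \<in> set xs \<Longrightarrow> length (f x) = c" "i < length xs" "j < c"
  shows "concat (map f xs) ! (i * c + j) = f (xs ! i) ! j"
  using assms
proof (induction xs arbitrary: i)
  case (Cons x xs)
  then show ?case by (cases i) (auto simp: nth_append)
qed simp

lemma length_concat_map:
  "(\<And>x. x \<in> set xs \<Longrightarrow> length (f x) = c) \<Longrightarrow> length (concat (map f xs)) = length xs * c"
  by (induction xs) auto

section \<open>Exact integer arithmetic for probabilities\<close>

definition scaled_value :: "nat \<Rightarrow> nat \<Rightarrow> nat" where
  "scaled_value D c = D * (pfst c div 2) div psnd c"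

lemma rat_code_eq:
  assumes "0 \<le> r"
  obtains p d :: nat where "0 < d" "d \<le> rat_code r" "r = of_nat p / of_nat d" "rat_code r = prod_encode (2 * p, d)"
proof -
  obtain p d where pd: "quotient_of r = (p, d)" by fastforce
  then have d: "0 < d" and r: "r = of_int p / of_int d"
    using quotient_of_denom_pos quotient_of_div by auto
  then have p: "0 \<le> p" using assms by (simp add: zero_le_divide_iff)
  have code: "rat_code r = prod_encode (2 * nat p, nat d)"
    using p by (simp add: rat_code_def pd int_encode_def sum_encode_def)
  show ?thesis
  proof (rule that[of "nat d" "nat p"])
    show "nat d \<le> rat_code r" unfolding code by (rule le_prod_encode_2)
    show "r = of_nat (nat p) / of_nat (nat d)" using p d r by simp
  qed (use d code in auto)
qed

text \<open>The code of a nonnegative \<open>p / d\<close> is \<open>prod_encode (2 * p, d)\<close>,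
  as \<open>int_encode\<close> doubles nonnegative integers. Since \<open>d\<close> is at most the
  code, it divides \<open>fact n\<close>, so the integer division is exact.\<close>

lemma scaled_value_rat_code:
  assumes "0 \<le> r" "rat_code r \<le> n"
  shows "of_nat (scaled_value (fact n) (rat_code r)) = r * of_nat (fact n)"
proof -
  from rat_code_eq[OF assms(1)] obtain p d :: nat
    where d: "0 < d" "d \<le> rat_code r" "r = of_nat p / of_nat d" "rat_code r = prod_encode (2 * p, d)" by blast
  then have "d dvd fact n" using assms(2) by (intro dvd_fact) auto
  then obtain e where e: "fact n = d * e" by auto
  show ?thesis using d by (simp add: scaled_value_def e)
qed

text \<open>
  Words and state sequences are enumerated by their digits in base \<open>card \<Sigma>\<close> and \<open>card Q\<close>.  All
  denominators are at most the input code \<open>n\<close>, so \<open>fact n\<close> is a common denominator, and every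
  other parameter of the automaton is bounded by \<open>n\<close> as well.
\<close>

definition scaled_run :: "nat \<Rightarrow> nat \<Rightarrow> nat \<Rightarrow> nat \<Rightarrow> nat" where
  "scaled_run n l u r =
     scaled_value (fact n) (code_nth (code_nth n 4) (digit (code_length (code_nth n 2)) r 0)) *
     (\<Prod>j<l. scaled_value (fact n) (code_nth (code_nth n 3)
        ((digit (code_length (code_nth n 2)) r j * code_length (code_nth n 1) +
          digit (code_length (code_nth n 1)) u j) * code_length (code_nth n 2) +
         digit (code_length (code_nth n 2)) r (Suc j)))) *
     (\<Sum>i<code_length (code_nth n 5). if code_nth (code_nth n 5) i =
        code_nth (code_nth n 2) (digit (code_length (code_nth n 2)) r l) then 1 else 0)"

definition scaled_word_prob :: "nat \<Rightarrow> nat \<Rightarrow> nat \<Rightarrow> nat" where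
  "scaled_word_prob n l u = (\<Sum>r<code_length (code_nth n 2) ^ Suc l. scaled_run n l u r)"

text \<open>A run over \<open>l\<close> letters multiplies \<open>Suc l\<close> probabilities, each
  scaled by \<open>fact n\<close>; hence the power in the comparison with one half.\<close>

definition violations :: "nat \<Rightarrow> nat" where
  "violations n = (\<Sum>l<word_bound (fact n) n. \<Sum>u<code_length (code_nth n 1) ^ l.
     if 2 * scaled_word_prob n l u \<le> fact n ^ Suc l then 0 else 1)"

lemma computable_digit:
  assumes "computable k b" "computable k u" "computable k i"
  shows "computable k (\<lambda>xs. digit (b xs) (u xs) (i xs))"
  unfolding digit_def by (intro assms computable_code_intros)

lemma computable_scaled_value:
  assumes "computable k D" "computable k c"
  shows "computable k (\<lambda>xs. scaled_value (D xs) (c xs))"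
  unfolding scaled_value_def by (intro assms computable_code_intros)

lemma computable_violations: "computable (Suc 0) (\<lambda>xs. violations (hd xs))"
  unfolding violations_def scaled_word_prob_def scaled_run_def word_bound_def trunc_bound_def
  by (intro computable_code_intros computable_digit computable_scaled_value)

section \<open>Correctness on coded automata\<close>

locale coded_automaton = prob_aut A for A :: "(nat, nat) pa" +
  fixes \<epsilon> :: rat
  assumes eps_pos: "0 < \<epsilon>"
begin

abbreviation "code \<equiv> input_code \<epsilon> A"
abbreviation "letters \<equiv> sorted_list_of_set \<Sigma>"
abbreviation "state_list \<equiv> sorted_list_of_set Q"

lemma set_letters: "set letters = \<Sigma>" "distinct letters"
  and set_state_list: "set state_list = Q" "distinct state_list"
  using finite_alphabet finite_states by auto

lemma code_eq: "code = list_encode [rat_code \<epsilon>, list_encode letters, list_encode state_list,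
    list_encode [rat_code (\<delta> q a p). q \<leftarrow> state_list, a \<leftarrow> letters, p \<leftarrow> state_list],
    list_encode [rat_code (\<iota> q). q \<leftarrow> state_list], list_encode (sorted_list_of_set (final A))]"
  by (simp add: input_code_def Let_def)

lemma code_nth_code:
  "code_nth code 1 = list_encode letters"
  "code_nth code 2 = list_encode state_list"
  "code_nth code 3 =
     list_encode [rat_code (\<delta> q a p). q \<leftarrow> state_list, a \<leftarrow> letters, p \<leftarrow> state_list]"
  "code_nth code 4 = list_encode [rat_code (\<iota> q). q \<leftarrow> state_list]"
  "code_nth code 5 = list_encode (sorted_list_of_set (final A))"
  unfolding code_eq by (simp_all add: code_nth_encode del: list_encode.simps)

lemma code_component_le:
  "list_encode letters \<le> code" "list_encode state_list \<le> code" "rat_code \<epsilon> \<le> code"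
  "list_encode [rat_code (\<delta> q a p). q \<leftarrow> state_list, a \<leftarrow> letters, p \<leftarrow> state_list] \<le> code"
  "list_encode [rat_code (\<iota> q). q \<leftarrow> state_list] \<le> code"
  unfolding code_eq by (rule mem_le_list_encode, simp)+

lemma trans_code_le: "q \<in> Q \<Longrightarrow> a \<in> \<Sigma> \<Longrightarrow> p \<in> Q \<Longrightarrow> rat_code (\<delta> q a p) \<le> code"
  using set_letters(1) set_state_list(1)
  by (intro order_trans[OF mem_le_list_encode code_component_le(4)]) auto

lemma init_code_le: "q \<in> Q \<Longrightarrow> rat_code (\<iota> q) \<le> code"
  using set_state_list(1) by (intro order_trans[OF mem_le_list_encode code_component_le(5)]) auto

lemma code_pos: "0 < code"
  by (simp add: code_eq)

lemma card_states_le: "card Q \<le> code"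
  using length_le_list_encode[of state_list] code_component_le(2) by simp

text \<open>A positive rational is at least the reciprocal of its denominator, which is bounded by
  the code of \<open>\<epsilon>\<close> and so by the whole code.\<close>

lemma inverse_code_le: "1 / of_nat code \<le> \<epsilon>"
proof -
  from rat_code_eq[of \<epsilon>] eps_pos obtain p d :: nat
    where d: "0 < d" "d \<le> rat_code \<epsilon>" "\<epsilon> = of_nat p / of_nat d" by (metis less_imp_le)
  then have "0 < p" using eps_pos by (cases p) auto
  have "1 / of_nat code \<le> (1 / of_nat d :: rat)"
    using d code_component_le(3) by (intro divide_left_mono) (auto intro!: mult_pos_pos code_pos)
  also have "\<dots> \<le> of_nat p / of_nat d"
    using d \<open>0 < p\<close> by (intro divide_right_mono) auto
  finally show ?thesis by (simp add: d)
qed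

lemma trans_fact_Nats: "q \<in> Q \<Longrightarrow> a \<in> \<Sigma> \<Longrightarrow> p \<in> Q \<Longrightarrow> \<delta> q a p * of_nat (fact code) \<in> \<nat>"
  using scaled_value_rat_code[OF trans_nonneg trans_code_le] by (metis of_nat_in_Nats)

text \<open>The table is a concatenation of rows, themselves concatenations of rows of equal length,
  so the position is a number in mixed radix and \<open>nth_concat_map\<close> is applied
  twice.\<close>

lemma trans_table_nth:
  assumes "i < length state_list" "j < length letters" "k < length state_list"
  shows "code_nth (code_nth code 3) ((i * length letters + j) * length state_list + k) =
    rat_code (\<delta> (state_list ! i) (letters ! j) (state_list ! k))"
proof -
  let ?m = "length state_list" and ?b = "length letters"
  let ?row = "\<lambda>q. [rat_code (\<delta> q a p). a \<leftarrow> letters, p \<leftarrow> state_list]"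
  have len: "length (?row q) = ?b * ?m" for q by (rule length_concat_map) simp
  have idx: "(i * ?b + j) * ?m + k = i * (?b * ?m) + (j * ?m + k)" by (simp add: algebra_simps)
  have "j * ?m + k < Suc j * ?m" using assms by simp
  also have "\<dots> \<le> ?b * ?m" using assms by (intro mult_right_mono) auto
  finally have jk: "j * ?m + k < ?b * ?m" .
  have "i * (?b * ?m) + (j * ?m + k) < Suc i * (?b * ?m)" using jk by simp
  also have "\<dots> \<le> ?m * (?b * ?m)" using assms by (intro mult_right_mono) auto
  finally have "i * (?b * ?m) + (j * ?m + k) < length (concat (map ?row state_list))"
    by (subst length_concat_map[OF len])
  then have "code_nth (code_nth code 3) ((i * ?b + j) * ?m + k) =
      concat (map ?row state_list) ! (i * (?b * ?m) + (j * ?m + k))"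
    unfolding code_nth_code idx by (rule code_nth_encode)
  also have "\<dots> = ?row (state_list ! i) ! (j * ?m + k)"
    using assms jk by (intro nth_concat_map len) auto
  also have "\<dots> = map (\<lambda>p. rat_code (\<delta> (state_list ! i) (letters ! j) p)) state_list ! k"
    using assms by (intro nth_concat_map) auto
  finally show ?thesis using assms by simp
qed

lemma scaled_word_prob_eq:
  assumes u: "u < length letters ^ l"
    and w: "w = map (\<lambda>i. letters ! digit (length letters) u i) [0..<l]"
  shows "of_nat (scaled_word_prob code l u) = word_prob A w * of_nat (fact code ^ Suc l)"
proof -
  let ?m = "length state_list" and ?b = "length letters"
  let ?D = "of_nat (fact code) :: rat"
  let ?g = "\<lambda>qs. \<iota> (qs ! 0) * (\<Prod>j<length w. \<delta> (qs ! j) (w ! j) (qs ! Suc j)) *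
    of_bool (qs ! length w \<in> final A)"
  let ?f = "\<lambda>r. map (\<lambda>i. state_list ! digit ?m r i) [0..<Suc l]"
  have lw: "length w = l" by (simp add: w)
  have "w \<in> {xs. length xs = l \<and> set xs \<subseteq> set letters}"
    unfolding w using bij_betwE[OF bij_betw_digits[OF set_letters(2)]] u by blast
  then have w_in: "w \<in> lists \<Sigma>" using set_letters(1) by auto
  have run: "of_nat (scaled_run code l u r) = ?g (?f r) * ?D ^ Suc l" if r: "r < ?m ^ Suc l" for r
  proof -
    \<comment> \<open>An index \<open>r\<close> in range forces at least one state, so every digit
      in this base is a valid state index.\<close>
    have "?m \<noteq> 0" using r by (cases "?m = 0") auto
    then have dm: "digit ?m r i < ?m" for i by (simp add: digit_def)
    have st: "state_list ! digit ?m r i \<in> Q" for i using dm set_state_list(1) nth_mem by blast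
    have f: "?f r ! i = state_list ! digit ?m r i" if "i \<le> l" for i
      using that by (simp del: upt_Suc)
    have init: "of_nat (scaled_value (fact code) (code_nth (code_nth code 4) (digit ?m r 0))) =
        \<iota> (?f r ! 0) * ?D"
      using dm st f[of 0] unfolding code_nth_code
      by (simp add: code_nth_encode scaled_value_rat_code init_nonneg init_code_le del: upt_Suc)
    have trans: "of_nat (scaled_value (fact code) (code_nth (code_nth code 3)
        ((digit ?m r j * ?b + digit ?b u j) * ?m + digit ?m r (Suc j)))) =
        \<delta> (?f r ! j) (w ! j) (?f r ! Suc j) * ?D" if j: "j < l" for j
    proof -
      have "?b \<noteq> 0" using u j by (cases "?b = 0") (auto simp: power_0_left)
      then have db: "digit ?b u j < ?b" by (simp add: digit_def)
      then have lt: "letters ! digit ?b u j \<in> \<Sigma>" using set_letters(1) nth_mem by blast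
      have wj: "w ! j = letters ! digit ?b u j" using j by (simp add: w)
      show ?thesis
        using j f[of j] f[of "Suc j"] st lt unfolding trans_table_nth[OF dm db dm] wj
        by (simp add: scaled_value_rat_code trans_nonneg trans_code_le del: upt_Suc)
    qed
    \<comment> \<open>The list of final states has no repetitions, so the count is 0 or 1 and equals
      the indicator.\<close>
    have fin: "(\<Sum>i<code_length (code_nth code 5). if code_nth (code_nth code 5) i =
        code_nth (code_nth code 2) (digit ?m r l) then 1 else 0) = (of_bool (?f r ! l \<in> final A) :: nat)"
    proof -
      let ?fs = "sorted_list_of_set (final A)"
      have fin: "finite (final A)" using final_subset finite_states finite_subset by blast
      have "(\<Sum>i<code_length (code_nth code 5). if code_nth (code_nth code 5) i =
        code_nth (code_nth code 2) (digit ?m r l) then 1 else 0) =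
        (\<Sum>i<length ?fs. if ?fs ! i = ?f r ! l then 1 else 0)"
        unfolding code_nth_code code_length_encode f[OF order_refl]
        using dm by (intro sum.cong) (auto simp: code_nth_encode)
      also have "\<dots> = (\<Sum>x\<in>final A. if x = ?f r ! l then 1 else 0)"
        by (rule sum.reindex_bij_betw[OF bij_betw_nth[of ?fs]]) (use fin in auto)
      also have "\<dots> = of_bool (?f r ! l \<in> final A)" using fin by simp
      finally show ?thesis .
    qed
    have prod: "(\<Prod>j<l. of_nat (scaled_value (fact code) (code_nth (code_nth code 3)
        ((digit ?m r j * ?b + digit ?b u j) * ?m + digit ?m r (Suc j))))) =
        (\<Prod>j<l. \<delta> (?f r ! j) (w ! j) (?f r ! Suc j) * ?D)"
      by (intro prod.cong refl trans) simp
    have "of_nat (scaled_run code l u r) =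
        (\<iota> (?f r ! 0) * ?D) * (\<Prod>j<l. \<delta> (?f r ! j) (w ! j) (?f r ! Suc j) * ?D) *
        of_bool (?f r ! l \<in> final A)"
    proof -
      have "code_length (code_nth code 2) = ?m" "code_length (code_nth code 1) = ?b"
        by (simp_all only: code_nth_code code_length_encode)
      then show ?thesis
        unfolding scaled_run_def by (simp only: fin of_nat_mult of_nat_prod init prod of_nat_of_bool)
    qed
    then show ?thesis by (simp add: lw prod.distrib mult_ac del: upt_Suc)
  qed
  have "of_nat (scaled_word_prob code l u) = (\<Sum>r<?m ^ Suc l. ?g (?f r) * ?D ^ Suc l)"
    unfolding scaled_word_prob_def code_nth_code code_length_encode of_nat_sum
    by (intro sum.cong) (simp_all only: run lessThan_iff)
  also have "\<dots> = (\<Sum>qs | length qs = Suc l \<and> set qs \<subseteq> Q. ?g qs * ?D ^ Suc l)"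
    using sum.reindex_bij_betw[OF bij_betw_digits[OF set_state_list(2)], of "\<lambda>qs. ?g qs * ?D ^ Suc l"]
    unfolding set_state_list(1) .
  also have "\<dots> = word_prob A w * ?D ^ Suc l"
    unfolding word_prob_sum[OF w_in] by (simp only: lw sum_distrib_right)
  finally show ?thesis by (simp only: of_nat_power)
qed

lemma violations_eq_0_iff:
  "violations code = 0 \<longleftrightarrow>
    (\<forall>w\<in>lists \<Sigma>. length w < word_bound (fact code) code \<longrightarrow> word_prob A w \<le> 1 / 2)"
proof -
  let ?b = "length letters"
  let ?word = "\<lambda>l u. map (\<lambda>i. letters ! digit ?b u i) [0..<l]"
  have le: "2 * scaled_word_prob code l u \<le> fact code ^ Suc l \<longleftrightarrow> word_prob A (?word l u) \<le> 1 / 2"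
    if "u < ?b ^ l" for l u
  proof -
    have "2 * scaled_word_prob code l u \<le> fact code ^ Suc l \<longleftrightarrow>
        of_nat (2 * scaled_word_prob code l u) \<le> (of_nat (fact code ^ Suc l) :: rat)"
      by (simp only: of_nat_le_iff)
    also have "\<dots> \<longleftrightarrow> (2 * word_prob A (?word l u)) * of_nat (fact code ^ Suc l) \<le> 1 * of_nat (fact code ^ Suc l)"
      using scaled_word_prob_eq[OF that refl] by (simp add: mult.assoc)
    also have "\<dots> \<longleftrightarrow> 2 * word_prob A (?word l u) \<le> 1"
      by (rule mult_le_cancel_right_pos) simp
    also have "\<dots> \<longleftrightarrow> word_prob A (?word l u) \<le> 1 / 2" by linarith
    finally show ?thesis .
  qed
  have words: "?word l ` {..<?b ^ l} = {w. length w = l \<and> set w \<subseteq> \<Sigma>}" for l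
    using bij_betw_digits[OF set_letters(2), of l] set_letters(1) by (simp add: bij_betw_def)
  have "violations code = 0 \<longleftrightarrow> (\<forall>l<word_bound (fact code) code. \<forall>u<?b ^ l.
      2 * scaled_word_prob code l u \<le> fact code ^ Suc l)"
    unfolding violations_def code_nth_code code_length_encode
    by (simp add: Ball_def del: power_Suc) blast
  also have "\<dots> \<longleftrightarrow> (\<forall>l<word_bound (fact code) code. \<forall>w\<in>?word l ` {..<?b ^ l}. word_prob A w \<le> 1 / 2)"
    using le by auto
  also have "\<dots> \<longleftrightarrow> (\<forall>w\<in>lists \<Sigma>. length w < word_bound (fact code) code \<longrightarrow> word_prob A w \<le> 1 / 2)"
    unfolding words by (auto simp: lists_eq_set)
  finally show ?thesis .
qed

end

theorem theorem1:
  "\<exists>f :: recf. \<forall>(\<epsilon> :: rat) (A :: (nat, nat) pa).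
     0 < \<epsilon> \<and> \<epsilon> < 1 \<and> prob_automaton A \<and> polynomially_ambiguous A \<and>
     ((\<exists>w\<in>lists (alphabet A). word_prob A w > 1/2 + \<epsilon>) \<or>
      (\<forall>w\<in>lists (alphabet A). word_prob A w \<le> 1/2))
     \<longrightarrow> eval_recf f [input_code \<epsilon> A] =
           Some (if \<forall>w\<in>lists (alphabet A). word_prob A w \<le> 1/2 then 1 else 0)"
proof -
  have "computable (Suc 0) (\<lambda>xs. if violations (hd xs) = 0 then 1 else 0)"
    by (intro computable_if0 computable_violations computable_const)
  then obtain f where f: "\<And>x. eval_recf f [x] = Some (if violations x = 0 then 1 else 0)"
    unfolding computable_def by (metis length_Cons list.sel(1) list.size(3))
  show ?thesis
  proof (intro exI[of _ f] allI impI)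
    fix \<epsilon> :: rat and A :: "(nat, nat) pa"
    assume *: "0 < \<epsilon> \<and> \<epsilon> < 1 \<and> prob_automaton A \<and> polynomially_ambiguous A \<and>
     ((\<exists>w\<in>lists (alphabet A). word_prob A w > 1/2 + \<epsilon>) \<or>
      (\<forall>w\<in>lists (alphabet A). word_prob A w \<le> 1/2))"
    then interpret coded_automaton A \<epsilon> by unfold_locales auto
    have "violations code = 0 \<longleftrightarrow> (\<forall>w\<in>lists \<Sigma>. word_prob A w \<le> 1 / 2)"
    proof
      assume v: "violations code = 0"
      show "\<forall>w\<in>lists \<Sigma>. word_prob A w \<le> 1 / 2"
      proof (rule ccontr)
        assume "\<not> (\<forall>w\<in>lists \<Sigma>. word_prob A w \<le> 1 / 2)"
        \<comment> \<open>The promise turns probability above one half into probability above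
          \<open>1 / 2 + \<epsilon>\<close>, which \<open>gap_short_word\<close> requires.\<close>
        with * obtain w where w: "w \<in> lists \<Sigma>" "word_prob A w > 1 / 2 + \<epsilon>" by blast
        have "polynomially_ambiguous A" using * by blast
        from gap_short_word[OF this trans_fact_Nats _ card_states_le code_pos inverse_code_le w]
        obtain v where "v \<in> lists \<Sigma>" "length v < word_bound (fact code) code" "word_prob A v > 1 / 2"
          by auto
        with v show False unfolding violations_eq_0_iff by fastforce
      qed
    qed (simp add: violations_eq_0_iff)
    then show "eval_recf f [code] = Some (if \<forall>w\<in>lists \<Sigma>. word_prob A w \<le> 1/2 then 1 else 0)"
      by (simp add: f)
  qed
qed

end
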